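(* Let $(A_0,A_1)$ be a Banach couple over $\mathbb{F}\in\{\mathbb{R},\mathbb{C}\}$ and let $\theta\in(0,1)$. Then $$\|a\|_{\langle A_0,A_1\rangle_{\theta,(0)}}=\lim_{r\searrow0}\|a\|_{\langle A_0,A_1\rangle_{\theta,(r)}}\quad\text{for every } a\in\langle A_0,A_1\rangle_{\theta,(0)}.$$
   Context: A Banach couple $(A_0,A_1)$ consists of two Banach spaces over the same field $\mathbb{F}$ continuously embedded in a common Hausdorff topological vector space. $A_0\cap A_1$ is normed by $\max\{\|a\|_{A_0},\|a\|_{A_1}\}$ and $A_0+A_1$ by $\inf\{\|a_0\|_{A_0}+\|a_1\|_{A_1}: a=a_0+a_1\}$. Discrete definition ($r>0$). Let $\Lambda$ be the set of all scalar sequences $\{\lambda_k\}_{k\in\mathbb{Z}}$ with $\sup_k|\lambda_k|\le1$. A series $\sum_{n\in\mathbb{Z}}x_n$ in a Banach space $A$ is unconditionally convergent if for every bounded scalar sequence $\{\lambda_n\}_{n\in\mathbb{Z}}$ the partial sums $\sum_{n=-N}^N\lambda_nx_n$ converge in norm in $A$ as $N\to\infty$. $J(\theta,r,A_0,A_1)$ is the space of all sequences $\{a_n\}_{n\in\mathbb{Z}}$ in $A_0\cap A_1$ such that $\sum_{n\in\mathbb{Z}}e^{(j-\theta)rn}a_n$ is unconditionally convergent in $A_j$ for $j=0$ and $j=1$, with norm $$\|\{a_n\}\|_{J(\theta,r,A_0,A_1)}=\sup\Big\{\Big\|\sum_{n=-\infty}^\infty\lambda_ne^{(j-\theta)rn}a_n\Big\|_{A_j}: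 j\in\{0,1\},\ \{\lambda_k\}\in\Lambda\Big\},$$ which is finite. For each such sequence, $\sum_{n=-\infty}^\infty a_n:=\lim_{N\to\infty}\sum_{n=-N}^{N}a_n$ exists in the norm of $A_0+A_1$. $\langle A_0,A_1\rangle_{\theta,(r)}$ is the space of all $a\in A_0+A_1$ of the form $a=\sum_{n=-\infty}^\infty a_n$ with $\{a_n\}\in J(\theta,r,A_0,A_1)$, normed by the infimum of $\|\{a_n\}\|_{J(\theta,r,A_0,A_1)}$ over all such representations. Continuous definition ($r=0$). A function on $\mathbb{R}$ is locally piecewise continuous if it is piecewise continuous on every bounded interval. Let $\Phi$ be the set of all locally piecewise continuous $\phi:\mathbb{R}\to\mathbb{F}$ with $\sup_{t}|\phi(t)|\le1$. Let $J$ (also written $J(\theta,A_0,A_1)$) be the space of all locally piecewise continuous $u:\mathbb{R}\to A_0\cap A_1$ such that, for $j=0$ and $j=1$ and every $\phi\in\Phi$, the Riemann integrals $\int_{-R}^Re^{(j-\theta)t}\phi(t)u(t)\,dt$ converge in the norm of $A_j$ as $R\to+\infty$; the limit is denoted $\int_{-\infty}^\infty e^{(j-\theta)t}\phi(t)u(t)\,dt$. $J$ carries the (finite) seminorm $$\|u\|_J=\sup\Big\{\Big\|\int_{-\infty}^\infty e^{(j-\theta)t}\phi(t)u(t)\,dt\Big\|_{A_j}: j\in\{0,1\},\ \phi\in\Phi\Big\}.$$ For $u\in J$, $\int_{-\infty}^\infty u(t)\,dt:=\lim_{R\to+\infty}\int_{-R}^{R}u(t)\,dt$ exists in the norm of $A_0+A_1$.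 $\langle A_0,A_1\rangle_{\theta,(0)}$ is the space of all $a\in A_0+A_1$ of the form $a=\int_{-\infty}^\infty u(t)\,dt$ with $u\in J$, normed by the infimum of $\|u\|_J$ over all such $u$. For every $r>0$ the sets $\langle A_0,A_1\rangle_{\theta,(r)}$ and $\langle A_0,A_1\rangle_{\theta,(0)}$ coincide, so the norms on the right-hand side are defined. *)

theory Defs
  imports "HOL-Analysis.Analysis"
begin

text \<open>
  A scalar field \<open>'f :: {real_normed_field, banach}\<close> is, by the Gelfand--Mazur theorem, isometrically
  isomorphic to the real or the complex numbers, and both of these types are instances. Library
  Banach spaces are real; a Banach space over \<open>'f\<close> is a library Banach space together with an
  explicit scalar multiplication that extends \<open>scaleR\<close>.
\<close>

locale banach_space_over = vector_space sc
  for sc :: "'f :: {real_normed_field, banach} \<Rightarrow> 'a :: banach \<Rightarrow> 'a" +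
  assumes scale_of_real: "sc (of_real r) x = r *\<^sub>R x"
    and norm_scale: "norm (sc c x) = norm c * norm x"

locale hausdorff_tvs_over = vector_space sc
  for sc :: "'f :: {real_normed_field, banach} \<Rightarrow>
      'v :: {topological_ab_group_add, t2_space} \<Rightarrow> 'v" +
  assumes continuous_scale: "continuous_on UNIV (\<lambda>(c, x). sc c x)"

definition bilateral_sum :: "(int \<Rightarrow> 'a :: real_normed_vector) \<Rightarrow> 'a" where
  "bilateral_sum x = lim (\<lambda>N. \<Sum>n = - int N..int N. x n)"

definition unconditionally_convergent ::
    "('f :: real_normed_field \<Rightarrow> 'a :: real_normed_vector \<Rightarrow> 'a) \<Rightarrow> (int \<Rightarrow> 'a) \<Rightarrow> bool" where
  "unconditionally_convergent sc x \<longleftrightarrow>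
    (\<forall>l :: int \<Rightarrow> 'f. bounded (range l) \<longrightarrow>
       convergent (\<lambda>N. \<Sum>n = - int N..int N. sc (l n) (x n)))"

definition unit_sequences :: "(int \<Rightarrow> 'f :: real_normed_field) set" where
  "unit_sequences = {l. \<forall>k. norm (l k) \<le> 1}"

text \<open>
  Piecewise continuity of a function with values in the subspace \<open>C\<close>, where limits are taken in
  \<open>C\<close> with respect to the norm \<open>N\<close>: all but finitely many points are points of continuity, and
  at the exceptional points the one-sided limits exist in \<open>C\<close>.
\<close>

definition piecewise_continuous_on ::
    "'w :: ab_group_add set \<Rightarrow> ('w \<Rightarrow> real) \<Rightarrow> real \<Rightarrow> real \<Rightarrow> (real \<Rightarrow> 'w) \<Rightarrow> bool" where
  "piecewise_continuous_on C N a b f \<longleftrightarrow>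
    (\<exists>S. finite S \<and>
      (\<forall>t \<in> {a..b} - S. ((\<lambda>s. N (f s - f t)) \<longlongrightarrow> 0) (at t within {a..b})) \<and>
      (\<forall>t \<in> {a..b} \<inter> S.
         (a < t \<longrightarrow> (\<exists>L \<in> C. ((\<lambda>s. N (f s - L)) \<longlongrightarrow> 0) (at_left t))) \<and>
         (t < b \<longrightarrow> (\<exists>L \<in> C. ((\<lambda>s. N (f s - L)) \<longlongrightarrow> 0) (at_right t)))))"

definition locally_piecewise_continuous ::
    "'w :: ab_group_add set \<Rightarrow> ('w \<Rightarrow> real) \<Rightarrow> (real \<Rightarrow> 'w) \<Rightarrow> bool" where
  "locally_piecewise_continuous C N f \<longleftrightarrow>
    (\<forall>t. f t \<in> C) \<and> (\<forall>a b. piecewise_continuous_on C N a b f)"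

definition unit_functions :: "(real \<Rightarrow> 'f :: real_normed_field) set" where
  "unit_functions = {\<phi>. locally_piecewise_continuous UNIV norm \<phi> \<and> (\<forall>t. norm (\<phi> t) \<le> 1)}"

text \<open>
  The integrals over compact intervals below are applied to piecewise continuous integrands only,
  for which the library's gauge integral is the Riemann integral.
\<close>

definition improper_integrable :: "(real \<Rightarrow> 'a :: banach) \<Rightarrow> bool" where
  "improper_integrable g \<longleftrightarrow> (\<exists>L. ((\<lambda>R. integral {-R..R} g) \<longlongrightarrow> L) at_top)"

definition improper_integral :: "(real \<Rightarrow> 'a :: banach) \<Rightarrow> 'a" where
  "improper_integral g = Lim at_top (\<lambda>R. integral {-R..R} g)"

text \<open>
  The Banach spaces \<open>A\<^sub>0\<close> and \<open>A\<^sub>1\<close> are the types \<open>'a\<close> and \<open>'b\<close>, embedded by \<open>i0\<close> and \<open>i1\<close> into the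
  topological vector space \<open>'v\<close>. An element of \<open>A\<^sub>j\<close>, regarded as an element of the common space,
  lies in the range of the embedding, and the inverse of the embedding leads back to \<open>A\<^sub>j\<close>.
\<close>

locale banach_couple =
  A0: banach_space_over s0 + A1: banach_space_over s1 + V: hausdorff_tvs_over sV +
  i0: Vector_Spaces.linear s0 sV i0 + i1: Vector_Spaces.linear s1 sV i1
  for s0 :: "'f :: {real_normed_field, banach} \<Rightarrow> 'a :: banach \<Rightarrow> 'a"
    and s1 :: "'f \<Rightarrow> 'b :: banach \<Rightarrow> 'b"
    and sV :: "'f \<Rightarrow> 'v :: {topological_ab_group_add, t2_space} \<Rightarrow> 'v"
    and i0 :: "'a \<Rightarrow> 'v"
    and i1 :: "'b \<Rightarrow> 'v" +
  assumes inj_i0: "inj i0" and continuous_i0: "continuous_on UNIV i0"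
    and inj_i1: "inj i1" and continuous_i1: "continuous_on UNIV i1"
begin

definition inter_space :: "'v set" where
  "inter_space = range i0 \<inter> range i1"

definition inter_norm :: "'v \<Rightarrow> real" where
  "inter_norm v = max (norm (inv i0 v)) (norm (inv i1 v))"

definition sum_space :: "'v set" where
  "sum_space = {i0 x + i1 y | x y. True}"

definition sum_norm :: "'v \<Rightarrow> real" where
  "sum_norm v = Inf {norm x + norm y | x y. v = i0 x + i1 y}"

definition weighted_seq0 :: "real \<Rightarrow> real \<Rightarrow> (int \<Rightarrow> 'v) \<Rightarrow> int \<Rightarrow> 'a" where
  "weighted_seq0 \<theta> r x n = exp ((0 - \<theta>) * r * of_int n) *\<^sub>R inv i0 (x n)"

definition weighted_seq1 :: "real \<Rightarrow> real \<Rightarrow> (int \<Rightarrow> 'v) \<Rightarrow> int \<Rightarrow> 'b" where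
  "weighted_seq1 \<theta> r x n = exp ((1 - \<theta>) * r * of_int n) *\<^sub>R inv i1 (x n)"

definition disc_J :: "real \<Rightarrow> real \<Rightarrow> (int \<Rightarrow> 'v) set" where
  "disc_J \<theta> r = {x. (\<forall>n. x n \<in> inter_space) \<and>
     unconditionally_convergent s0 (weighted_seq0 \<theta> r x) \<and>
     unconditionally_convergent s1 (weighted_seq1 \<theta> r x)}"

definition disc_J_norm :: "real \<Rightarrow> real \<Rightarrow> (int \<Rightarrow> 'v) \<Rightarrow> real" where
  "disc_J_norm \<theta> r x = Sup
     ({norm (bilateral_sum (\<lambda>n. s0 (l n) (weighted_seq0 \<theta> r x n))) | l. l \<in> unit_sequences} \<union>
      {norm (bilateral_sum (\<lambda>n. s1 (l n) (weighted_seq1 \<theta> r x n))) | l. l \<in> unit_sequences})"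

definition disc_representations :: "real \<Rightarrow> real \<Rightarrow> 'v \<Rightarrow> (int \<Rightarrow> 'v) set" where
  "disc_representations \<theta> r a = {x \<in> disc_J \<theta> r. a \<in> sum_space \<and>
     (\<lambda>N. sum_norm ((\<Sum>n = - int N..int N. x n) - a)) \<longlonglongrightarrow> 0}"

definition disc_space :: "real \<Rightarrow> real \<Rightarrow> 'v set" where
  "disc_space \<theta> r = {a. disc_representations \<theta> r a \<noteq> {}}"

definition disc_norm :: "real \<Rightarrow> real \<Rightarrow> 'v \<Rightarrow> real" where
  "disc_norm \<theta> r a = Inf (disc_J_norm \<theta> r ` disc_representations \<theta> r a)"

definition weighted_fun0 :: "real \<Rightarrow> (real \<Rightarrow> 'v) \<Rightarrow> real \<Rightarrow> 'a" where
  "weighted_fun0 \<theta> u t = exp ((0 - \<theta>) * t) *\<^sub>R inv i0 (u t)"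

definition weighted_fun1 :: "real \<Rightarrow> (real \<Rightarrow> 'v) \<Rightarrow> real \<Rightarrow> 'b" where
  "weighted_fun1 \<theta> u t = exp ((1 - \<theta>) * t) *\<^sub>R inv i1 (u t)"

definition cont_J :: "real \<Rightarrow> (real \<Rightarrow> 'v) set" where
  "cont_J \<theta> = {u. locally_piecewise_continuous inter_space inter_norm u \<and>
     (\<forall>\<phi> \<in> unit_functions. improper_integrable (\<lambda>t. s0 (\<phi> t) (weighted_fun0 \<theta> u t)) \<and>
        improper_integrable (\<lambda>t. s1 (\<phi> t) (weighted_fun1 \<theta> u t)))}"

definition cont_J_norm :: "real \<Rightarrow> (real \<Rightarrow> 'v) \<Rightarrow> real" where
  "cont_J_norm \<theta> u = Sup
     ({norm (improper_integral (\<lambda>t. s0 (\<phi> t) (weighted_fun0 \<theta> u t))) | \<phi>. \<phi> \<in> unit_functions} \<union>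
      {norm (improper_integral (\<lambda>t. s1 (\<phi> t) (weighted_fun1 \<theta> u t))) | \<phi>. \<phi> \<in> unit_functions})"

text \<open>
  For \<open>u\<close> in \<open>cont_J \<theta>\<close>, the integral of \<open>u\<close> over a compact interval is computed here in \<open>A\<^sub>0\<close>;
  since \<open>u\<close> is piecewise continuous into the intersection, it is the same element of the common
  space when computed in \<open>A\<^sub>1\<close>, in the intersection or in the sum.
\<close>

definition cont_representations :: "real \<Rightarrow> 'v \<Rightarrow> (real \<Rightarrow> 'v) set" where
  "cont_representations \<theta> a = {u \<in> cont_J \<theta>. a \<in> sum_space \<and>
     ((\<lambda>R. sum_norm (i0 (integral {-R..R} (\<lambda>t. inv i0 (u t))) - a)) \<longlongrightarrow> 0) at_top}"

definition cont_space :: "real \<Rightarrow> 'v set" where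
  "cont_space \<theta> = {a. cont_representations \<theta> a \<noteq> {}}"

definition cont_norm :: "real \<Rightarrow> 'v \<Rightarrow> real" where
  "cont_norm \<theta> a = Inf (cont_J_norm \<theta> ` cont_representations \<theta> a)"

end

end

theory Submission
  imports Defs
begin

text \<open>
  Cut the line into cells of length \<open>r\<close> centred at the points \<open>r n\<close>, so that the cells with index
  between \<open>-N\<close> and \<open>N\<close> fill a symmetric interval. Integrating \<open>u\<close> over the cells gives a sequence
  representing the same element, and spreading a sequence uniformly over the cells gives a function
  representing the same element. On each cell the weights \<open>e\<^bsup>(j - \<theta>) t\<^esup>\<close> and
  \<open>e\<^bsup>(j - \<theta>) r n\<^esup>\<close> differ by a factor at most \<open>e\<^bsup>r\<^esup>\<close>, which can be moved into the multipliers, so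
  neither passage increases the \<open>J\<close>-norm by more than \<open>e\<^bsup>r\<^esup>\<close>. Hence the two interpolation norms agree
  up to this factor, and \<open>r\<close> tends to \<open>0\<close>.
\<close>

text \<open>Two points shape the proof. First, both \<open>J\<close>-norms are suprema of real sets,
  and the hypotheses give convergence only for each multiplier separately. Before a single integral
  or sum can be compared with such a supremum, a bound uniform in the multiplier is needed; for
  functions a gliding hump supplies it, and for sequences it is then inherited through the passage
  to step functions. Second, sums converge along integers but integrals along real radii. From
  functions to sequences one merely restricts the radius to the nodes; in the other direction a
  radius cuts the two outermost cells, and the cut pieces must be shown to vanish. In the sum norm
  this works because the negative terms are small in \<open>A\<^sub>0\<close> and the positive ones
  in \<open>A\<^sub>1\<close>. All estimates inside one space are made for an exponent c with |c| at
  most 1, standing for -\<theta> and 1 - \<theta>. Any factor that tends to 1 with r would do in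
  place of exp r.\<close>

section \<open>Locally piecewise continuous functions\<close>

text \<open>A set without accumulation points meets a compact interval in a finite set, so the
  exceptional sets chosen for the various intervals amount to a condition near each point. In this
  local form products, gluings and step functions need no bookkeeping of finite sets.\<close>

lemma locally_piecewise_continuous_iff:
  "locally_piecewise_continuous C N f \<longleftrightarrow> (\<forall>t. f t \<in> C) \<and>
    (\<forall>t. (\<exists>L\<in>C. ((\<lambda>s. N (f s - L)) \<longlongrightarrow> 0) (at_left t)) \<and>
         (\<exists>L\<in>C. ((\<lambda>s. N (f s - L)) \<longlongrightarrow> 0) (at_right t)) \<and>
         (\<forall>\<^sub>F s in at t. ((\<lambda>x. N (f x - f s)) \<longlongrightarrow> 0) (at s)))"
    (is "?L \<longleftrightarrow> ?V \<and> (\<forall>t. ?R t)")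
proof
  assume L: ?L
  then have V: ?V by (simp add: locally_piecewise_continuous_def)
  moreover have "?R t" for t
  proof -
    have "piecewise_continuous_on C N (t - 1) (t + 1) f"
      using L by (simp add: locally_piecewise_continuous_def)
    then obtain S where S: "finite S"
      and c: "\<And>s. s \<in> {t - 1..t + 1} - S \<Longrightarrow> ((\<lambda>x. N (f x - f s)) \<longlongrightarrow> 0) (at s within {t - 1..t + 1})"
      and d: "t \<in> S \<Longrightarrow> (\<exists>L\<in>C. ((\<lambda>s. N (f s - L)) \<longlongrightarrow> 0) (at_left t)) \<and>
         (\<exists>L\<in>C. ((\<lambda>s. N (f s - L)) \<longlongrightarrow> 0) (at_right t))"
      unfolding piecewise_continuous_on_def by fastforce
    have c': "((\<lambda>x. N (f x - f s)) \<longlongrightarrow> 0) (at s)" if "s \<in> {t - 1<..<t + 1}" "s \<notin> S" for s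
    proof -
      have "at s within {t - 1..t + 1} = at s"
        using that(1) by (intro at_within_interior) (simp add: interior_atLeastAtMost_real)
      then show ?thesis using c[of s] that by auto
    qed
    have "\<forall>\<^sub>F s in at t. s \<in> {t - 1<..<t + 1}"
      by (rule eventually_at_in_open') auto
    moreover have "\<forall>\<^sub>F s in at t. s \<notin> S"
      using S islimpt_finite islimpt_iff_eventually by blast
    ultimately have "\<forall>\<^sub>F s in at t. ((\<lambda>x. N (f x - f s)) \<longlongrightarrow> 0) (at s)"
      by eventually_elim (rule c')
    moreover have "(\<exists>L\<in>C. ((\<lambda>s. N (f s - L)) \<longlongrightarrow> 0) (at_left t)) \<and>
         (\<exists>L\<in>C. ((\<lambda>s. N (f s - L)) \<longlongrightarrow> 0) (at_right t))"
    proof (cases "t \<in> S")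
      case False
      then have "((\<lambda>x. N (f x - f t)) \<longlongrightarrow> 0) (at t)" by (intro c') auto
      then show ?thesis using V by (meson filterlim_at_split)
    qed (rule d)
    ultimately show ?thesis by blast
  qed
  ultimately show "?V \<and> (\<forall>t. ?R t)" by blast
next
  assume R: "?V \<and> (\<forall>t. ?R t)"
  show ?L
    unfolding locally_piecewise_continuous_def piecewise_continuous_on_def
  proof (intro conjI allI)
    fix a b
    define D where "D = {s. \<not> ((\<lambda>x. N (f x - f s)) \<longlongrightarrow> 0) (at s)}"
    have "finite ({a..b} \<inter> D)"
    proof (rule finite_not_islimpt_in_compact)
      fix z
      have "\<forall>\<^sub>F s in at z. s \<notin> D" using R by (simp add: D_def)
      then show "\<not> z islimpt D" by (simp add: islimpt_iff_eventually)
    qed simp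
    then show "\<exists>S. finite S \<and>
      (\<forall>t \<in> {a..b} - S. ((\<lambda>s. N (f s - f t)) \<longlongrightarrow> 0) (at t within {a..b})) \<and>
      (\<forall>t \<in> {a..b} \<inter> S.
         (a < t \<longrightarrow> (\<exists>L \<in> C. ((\<lambda>s. N (f s - L)) \<longlongrightarrow> 0) (at_left t))) \<and>
         (t < b \<longrightarrow> (\<exists>L \<in> C. ((\<lambda>s. N (f s - L)) \<longlongrightarrow> 0) (at_right t))))"
      using R
      by (intro exI[of _ "{a..b} \<inter> D"]) (auto simp: D_def intro: tendsto_within_subset)
  qed (use R in auto)
qed

lemma locally_piecewise_continuous_norm_iff:
  fixes f :: "real \<Rightarrow> 'a :: real_normed_vector"
  shows "locally_piecewise_continuous UNIV norm f \<longleftrightarrow>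
    (\<forall>t. (\<exists>L. (f \<longlongrightarrow> L) (at_left t)) \<and> (\<exists>L. (f \<longlongrightarrow> L) (at_right t)) \<and>
         (\<forall>\<^sub>F s in at t. isCont f s))"
  by (simp add: locally_piecewise_continuous_iff tendsto_norm_zero_iff LIM_zero_iff isCont_def)

lemma locally_piecewise_continuous_continuous:
  fixes f :: "real \<Rightarrow> 'a :: real_normed_vector"
  assumes "continuous_on UNIV f"
  shows "locally_piecewise_continuous UNIV norm f"
proof -
  have "isCont f t" for t using assms by (simp add: continuous_on_eq_continuous_at)
  then show ?thesis
    unfolding locally_piecewise_continuous_norm_iff isCont_def
    by (meson filterlim_at_split always_eventually)
qed

lemma locally_piecewise_continuous_bilinear:
  assumes "bounded_bilinear p"
    and f: "locally_piecewise_continuous UNIV norm f"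
    and g: "locally_piecewise_continuous UNIV norm g"
  shows "locally_piecewise_continuous UNIV norm (\<lambda>t. p (f t) (g t))"
  unfolding locally_piecewise_continuous_norm_iff
proof (intro allI conjI)
  interpret bounded_bilinear p by fact
  fix t
  show "\<exists>L. ((\<lambda>t. p (f t) (g t)) \<longlongrightarrow> L) (at_left t)" "\<exists>L. ((\<lambda>t. p (f t) (g t)) \<longlongrightarrow> L) (at_right t)"
    using f g unfolding locally_piecewise_continuous_norm_iff by (blast intro: tendsto)+
  have "\<forall>\<^sub>F s in at t. isCont f s" "\<forall>\<^sub>F s in at t. isCont g s"
    using f g by (simp_all add: locally_piecewise_continuous_norm_iff)
  then show "\<forall>\<^sub>F s in at t. isCont (\<lambda>t. p (f t) (g t)) s"
    by eventually_elim (rule isCont)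
qed

lemma locally_piecewise_continuous_norm:
  fixes f :: "real \<Rightarrow> 'a :: real_normed_vector"
  assumes "locally_piecewise_continuous UNIV norm f"
  shows "locally_piecewise_continuous UNIV norm (\<lambda>t. norm (f t))"
  unfolding locally_piecewise_continuous_norm_iff
proof (intro allI conjI)
  fix t
  show "\<exists>L. ((\<lambda>t. norm (f t)) \<longlongrightarrow> L) (at_left t)" "\<exists>L. ((\<lambda>t. norm (f t)) \<longlongrightarrow> L) (at_right t)"
    using assms unfolding locally_piecewise_continuous_norm_iff by (blast intro: tendsto_norm)+
  have "\<forall>\<^sub>F s in at t. isCont f s"
    using assms by (simp add: locally_piecewise_continuous_norm_iff)
  then show "\<forall>\<^sub>F s in at t. isCont (\<lambda>t. norm (f t)) s"
    by eventually_elim (rule continuous_norm)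
qed

text \<open>One-sided limits at t see only one-sided germs, and continuity near t is tested at
  points of an open interval on one side of t, where f coincides with a single model. The models for
  the two sides may differ, which covers gluings at a breakpoint and step functions.\<close>

lemma locally_piecewise_continuous_cong_local:
  assumes C: "\<And>t. f t \<in> C"
    and l: "\<And>t. \<exists>g. locally_piecewise_continuous C N g \<and> eventually (\<lambda>s. f s = g s) (at_left t)"
    and r: "\<And>t. \<exists>g. locally_piecewise_continuous C N g \<and> eventually (\<lambda>s. f s = g s) (at_right t)"
  shows "locally_piecewise_continuous C N f"
  unfolding locally_piecewise_continuous_iff
proof (intro allI conjI)
  fix t
  obtain g where g: "locally_piecewise_continuous C N g" and fg: "eventually (\<lambda>s. f s = g s) (at_left t)"
    using l by blast
  obtain h where h: "locally_piecewise_continuous C N h" and fh: "eventually (\<lambda>s. f s = h s) (at_right t)"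
    using r by blast
  have same: "((\<lambda>s. N (f s - L)) \<longlongrightarrow> 0) F"
    if "((\<lambda>s. N (k s - L)) \<longlongrightarrow> 0) F" "eventually (\<lambda>s. f s = k s) F" for k L F
    using that(1) by (rule Lim_transform_eventually) (use that(2) in eventually_elim, simp)
  show "\<exists>L\<in>C. ((\<lambda>s. N (f s - L)) \<longlongrightarrow> 0) (at_left t)"
    using g fg same unfolding locally_piecewise_continuous_iff by meson
  show "\<exists>L\<in>C. ((\<lambda>s. N (f s - L)) \<longlongrightarrow> 0) (at_right t)"
    using h fh same unfolding locally_piecewise_continuous_iff by meson
  have cont: "((\<lambda>x. N (f x - f s)) \<longlongrightarrow> 0) (at s)"
    if "((\<lambda>x. N (k x - k s)) \<longlongrightarrow> 0) (at s)" "open S" "s \<in> S" "\<And>x. x \<in> S \<Longrightarrow> f x = k x" for s k S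
  proof -
    have "eventually (\<lambda>x. x \<in> S) (at s)" using that by (intro eventually_at_in_open')
    then have "eventually (\<lambda>x. f x = k x) (at s)" by eventually_elim (rule that)
    then show ?thesis using same[of k "f s"] that by simp
  qed
  show "\<forall>\<^sub>F s in at t. ((\<lambda>x. N (f x - f s)) \<longlongrightarrow> 0) (at s)"
  proof (subst eventually_at_split, intro conjI)
    obtain b where b: "b < t" "\<And>x. x \<in> {b<..<t} \<Longrightarrow> f x = g x"
      using fg by (auto simp: eventually_at_left_field)
    have "\<forall>\<^sub>F s in at_left t. s \<in> {b<..<t}" using b(1) by (rule eventually_at_left_real)
    moreover have "\<forall>\<^sub>F s in at_left t. ((\<lambda>x. N (g x - g s)) \<longlongrightarrow> 0) (at s)"
      using g unfolding locally_piecewise_continuous_iff eventually_at_split by blast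
    ultimately show "\<forall>\<^sub>F s in at_left t. ((\<lambda>x. N (f x - f s)) \<longlongrightarrow> 0) (at s)"
      by eventually_elim (rule cont[where k = g and S = "{b<..<t}"], use b in auto)
    obtain b where b: "t < b" "\<And>x. x \<in> {t<..<b} \<Longrightarrow> f x = h x"
      using fh by (auto simp: eventually_at_right_field)
    have "\<forall>\<^sub>F s in at_right t. s \<in> {t<..<b}" using b(1) by (rule eventually_at_right_real)
    moreover have "\<forall>\<^sub>F s in at_right t. ((\<lambda>x. N (h x - h s)) \<longlongrightarrow> 0) (at s)"
      using h unfolding locally_piecewise_continuous_iff eventually_at_split by blast
    ultimately show "\<forall>\<^sub>F s in at_right t. ((\<lambda>x. N (f x - f s)) \<longlongrightarrow> 0) (at s)"
      by eventually_elim (rule cont[where k = h and S = "{t<..<b}"], use b in auto)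
  qed
qed (rule C)

lemma locally_piecewise_continuous_const:
  assumes "v \<in> C" "N 0 = 0"
  shows "locally_piecewise_continuous C N (\<lambda>_. v)"
  using assms unfolding locally_piecewise_continuous_iff by (auto intro!: bexI[of _ v])

text \<open>On either side of any point the condition on |s| is eventually constant, so one of f and
  g serves as the germ. This admits the glued multipliers of the gliding hump.\<close>

lemma locally_piecewise_continuous_if_cball:
  assumes "locally_piecewise_continuous C N f" "locally_piecewise_continuous C N g"
  shows "locally_piecewise_continuous C N (\<lambda>t. if \<bar>t\<bar> \<le> T then f t else g t)"
proof (rule locally_piecewise_continuous_cong_local)
  fix t :: real
  have ev: "\<exists>h. locally_piecewise_continuous C N h \<and>
      eventually (\<lambda>s. (if \<bar>s\<bar> \<le> T then f s else g s) = h s) F"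
    if "eventually (\<lambda>s. \<bar>s\<bar> \<le> T) F \<or> eventually (\<lambda>s. \<not> \<bar>s\<bar> \<le> T) F" for F
    using that
  proof
    assume "eventually (\<lambda>s. \<bar>s\<bar> \<le> T) F"
    then show ?thesis using assms(1) by (intro exI[of _ f] conjI) (auto elim: eventually_mono)
  next
    assume "eventually (\<lambda>s. \<not> \<bar>s\<bar> \<le> T) F"
    then show ?thesis using assms(2) by (intro exI[of _ g] conjI) (auto elim: eventually_mono)
  qed
  have L: "eventually P (at_left t)" if "b < t" "\<And>s. s \<in> {b<..<t} \<Longrightarrow> P s" for P b
    using eventually_at_left_real[OF that(1)] by eventually_elim (rule that(2))
  have R: "eventually P (at_right t)" if "t < b" "\<And>s. s \<in> {t<..<b} \<Longrightarrow> P s" for P b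
    using eventually_at_right_real[OF that(1)] by eventually_elim (rule that(2))
  have "eventually (\<lambda>s. \<bar>s\<bar> \<le> T) (at_left t) \<or> eventually (\<lambda>s. \<not> \<bar>s\<bar> \<le> T) (at_left t)"
  proof -
    consider "T < 0" | "T \<ge> 0" "t \<le> - T" | "- T < t" "t \<le> T" | "T \<ge> 0" "T < t" by linarith
    then show ?thesis
    proof cases
      case 1 then have "\<not> \<bar>s\<bar> \<le> T" for s by linarith
      then show ?thesis by simp
    next
      case 2 then show ?thesis by (intro disjI2 L[of "t - 1"]) auto
    next
      case 3 then show ?thesis by (intro disjI1 L[of "- T"]) auto
    next
      case 4 then show ?thesis by (intro disjI2 L[of T]) auto
    qed
  qed
  then show "\<exists>h. locally_piecewise_continuous C N h \<and>
      eventually (\<lambda>s. (if \<bar>s\<bar> \<le> T then f s else g s) = h s) (at_left t)" by (rule ev)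
  have "eventually (\<lambda>s. \<bar>s\<bar> \<le> T) (at_right t) \<or> eventually (\<lambda>s. \<not> \<bar>s\<bar> \<le> T) (at_right t)"
  proof -
    consider "T < 0" | "T \<ge> 0" "t < - T" | "- T \<le> t" "t < T" | "T \<ge> 0" "T \<le> t" by linarith
    then show ?thesis
    proof cases
      case 1 then have "\<not> \<bar>s\<bar> \<le> T" for s by linarith
      then show ?thesis by simp
    next
      case 2 then show ?thesis by (intro disjI2 R[of "-T"]) auto
    next
      case 3 then show ?thesis by (intro disjI1 R[of "T"]) auto
    next
      case 4 then show ?thesis by (intro disjI2 R[of "t+1"]) auto
    qed
  qed
  then show "\<exists>h. locally_piecewise_continuous C N h \<and>
      eventually (\<lambda>s. (if \<bar>s\<bar> \<le> T then f s else g s) = h s) (at_right t)" by (rule ev)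
  show "(if \<bar>t\<bar> \<le> T then f t else g t) \<in> C"
    using assms by (simp add: locally_piecewise_continuous_def)
qed

text \<open>Meant for h an inverse embedding, which the intersection norm controls only on the
  intersection. This is why the estimate is asked on C alone, and why the one-sided limits have to
  lie in C.\<close>

lemma locally_piecewise_continuous_comp:
  assumes f: "locally_piecewise_continuous C N f"
    and h: "\<And>v w. v \<in> C \<Longrightarrow> w \<in> C \<Longrightarrow> norm (h v - h w) \<le> N (v - w)"
  shows "locally_piecewise_continuous UNIV norm (\<lambda>t. h (f t))"
proof -
  have C: "f t \<in> C" for t using f by (simp add: locally_piecewise_continuous_def)
  have lim: "((\<lambda>s. norm (h (f s) - h L)) \<longlongrightarrow> 0) F"
    if "((\<lambda>s. N (f s - L)) \<longlongrightarrow> 0) F" "L \<in> C" for L F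
    by (rule Lim_null_comparison[OF _ that(1)]) (use h[OF C that(2)] in simp)
  show ?thesis
    unfolding locally_piecewise_continuous_iff
  proof (intro allI conjI)
    fix t
    show "\<exists>L\<in>UNIV. ((\<lambda>s. norm (h (f s) - L)) \<longlongrightarrow> 0) (at_left t)"
      "\<exists>L\<in>UNIV. ((\<lambda>s. norm (h (f s) - L)) \<longlongrightarrow> 0) (at_right t)"
      using f lim unfolding locally_piecewise_continuous_iff by blast+
    have "\<forall>\<^sub>F s in at t. ((\<lambda>x. N (f x - f s)) \<longlongrightarrow> 0) (at s)"
      using f unfolding locally_piecewise_continuous_iff by blast
    then show "\<forall>\<^sub>F s in at t. ((\<lambda>x. norm (h (f x) - h (f s))) \<longlongrightarrow> 0) (at s)"
      by eventually_elim (rule lim[OF _ C])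
  qed simp
qed

lemma integrable_on_one_sided_limits:
  fixes f :: "real \<Rightarrow> 'a :: banach"
  assumes c: "\<And>s. s \<in> {a<..<b} \<Longrightarrow> isCont f s"
    and l: "(f \<longlongrightarrow> L) (at_right a)" and r: "(f \<longlongrightarrow> M) (at_left b)"
  shows "f integrable_on {a..b}"
proof (cases "a < b")
  case True
  \<comment> \<open>Putting the one-sided limits at the endpoints gives a function continuous on the
    closed interval that differs from f in at most two points.\<close>
  define g where "g t = (if t = a then L else if t = b then M else f t)" for t
  have "continuous_on {a..b} g"
  proof (rule continuous_on_IccI)
    have near: "(g \<longlongrightarrow> K) F" if "(f \<longlongrightarrow> K) F" "eventually (\<lambda>t. t \<in> {a<..<b}) F" for K F
      using that(1)
      by (rule Lim_transform_eventually) (use that(2) in eventually_elim, auto simp: g_def)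
    show "(g \<longlongrightarrow> g a) (at_right a)"
      using near[OF l eventually_at_right_real[OF True]] by (simp add: g_def)
    show "(g \<longlongrightarrow> g b) (at_left b)"
      using near[OF r eventually_at_left_real[OF True]] True by (simp add: g_def)
    fix x assume x: "a < x" "x < b"
    then have "eventually (\<lambda>t. t \<in> {a<..<b}) (at x)" by (intro eventually_at_in_open') auto
    then show "(g \<longlongrightarrow> g x) (at x)"
      using near[of "f x" "at x"] c[of x] x by (simp add: g_def isCont_def)
  qed (rule True)
  then have "g integrable_on {a..b}" by (rule integrable_continuous_real)
  then show ?thesis
    by (rule integrable_spike_finite[of "{a, b}", rotated 2]) (auto simp: g_def)
next
  case False
  then show ?thesis
    by (intro integrable_spike_finite[of "{a, b}" "{a..b}" f "\<lambda>_. 0"]) auto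
qed

text \<open>Bisection: every short interval around x splits at x into two pieces, in whose interiors
  f is continuous and at whose ends it has one-sided limits. Bolzano's principle passes from short
  intervals to all.\<close>

lemma locally_piecewise_continuous_integrable:
  fixes f :: "real \<Rightarrow> 'a :: banach"
  assumes f: "locally_piecewise_continuous UNIV norm f"
  shows "f integrable_on {a..b}"
proof (cases "a \<le> b")
  case True
  then show ?thesis
  proof (rule Bolzano[where P = "\<lambda>a b. f integrable_on {a..b}"])
    fix x
    from f obtain L M where L: "(f \<longlongrightarrow> L) (at_left x)" and M: "(f \<longlongrightarrow> M) (at_right x)"
      and "\<forall>\<^sub>F s in at x. isCont f s"
      unfolding locally_piecewise_continuous_norm_iff by blast
    then obtain d where "d > 0" and d: "\<And>s. s \<noteq> x \<Longrightarrow> dist s x < d \<Longrightarrow> isCont f s"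
      unfolding eventually_at by blast
    have "f integrable_on {a..b}" if "a \<le> x" "x \<le> b" "b - a < d" for a b
    proof (rule Henstock_Kurzweil_Integration.integrable_combine)
      have cont: "isCont f s" if "s \<in> {a..b}" "s \<noteq> x" for s
        using that \<open>a \<le> x\<close> \<open>x \<le> b\<close> \<open>b - a < d\<close> by (intro d) (auto simp: dist_real_def)
      have lim: "\<exists>L. (f \<longlongrightarrow> L) (at_right s)" "\<exists>L. (f \<longlongrightarrow> L) (at_left s)" for s
        using f unfolding locally_piecewise_continuous_norm_iff by blast+
      show "f integrable_on {a..x}"
        using lim(1)[of a] L \<open>x \<le> b\<close> by (auto intro!: integrable_on_one_sided_limits cont)
      show "f integrable_on {x..b}"
        using lim(2)[of b] M \<open>a \<le> x\<close> by (auto intro!: integrable_on_one_sided_limits cont)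
    qed (use that in auto)
    with \<open>d > 0\<close> show "\<exists>d>0. \<forall>a b. a \<le> x \<and> x \<le> b \<and> b - a < d \<longrightarrow> f integrable_on {a..b}" by blast
  qed (rule Henstock_Kurzweil_Integration.integrable_combine)
qed auto

section \<open>Improper integrals against bounded multipliers\<close>

lemma integral_symmetric_diff:
  fixes f :: "real \<Rightarrow> 'a :: banach"
  assumes "\<And>a b. f integrable_on {a..b}" "0 \<le> R" "R \<le> R'"
  shows "integral {-R'..R'} f - integral {-R..R} f = integral {-R'..-R} f + integral {R..R'} f"
proof -
  have 1: "integral {-R'..-R} f + integral {-R..R'} f = integral {-R'..R'} f"
    by (rule Henstock_Kurzweil_Integration.integral_combine) (use assms in auto)
  have 2: "integral {-R..R} f + integral {R..R'} f = integral {-R..R'} f"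
    by (rule Henstock_Kurzweil_Integration.integral_combine) (use assms in auto)
  show ?thesis unfolding 1[symmetric] 2[symmetric] by simp
qed

section \<open>Bounds uniform over all multipliers in one Banach space\<close>

context banach_space_over
begin

lemma scale_scaleR: "sc (r *\<^sub>R c) x = r *\<^sub>R sc c x" "sc c (r *\<^sub>R x) = r *\<^sub>R sc c x"
proof -
  have "sc (r *\<^sub>R c) x = sc (of_real r * c) x" by (simp add: scaleR_conv_of_real)
  then show "sc (r *\<^sub>R c) x = r *\<^sub>R sc c x"
    by (simp flip: scale_scale add: scale_of_real)
  show "sc c (r *\<^sub>R x) = r *\<^sub>R sc c x"
    by (simp flip: scale_of_real add: scale_left_commute)
qed

lemma bounded_bilinear_scale: "bounded_bilinear sc"
proof
  have "\<forall>c x. norm (sc c x) \<le> norm c * norm x * 1" by (simp add: norm_scale)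
  then show "\<exists>K. \<forall>c x. norm (sc c x) \<le> norm c * norm x * K" ..
qed (simp_all only: scale_left_distrib scale_right_distrib scale_scaleR)

lemma scale_integrable:
  assumes "\<phi> \<in> unit_functions" "locally_piecewise_continuous UNIV norm w"
  shows "(\<lambda>t. sc (\<phi> t) (w t)) integrable_on {a..b}"
  using assms
  by (intro locally_piecewise_continuous_integrable
      locally_piecewise_continuous_bilinear[OF bounded_bilinear_scale])
    (auto simp: unit_functions_def)

text \<open>
  A gliding hump: were there no such \<open>R0\<close>, multipliers violating the bound on disjoint annuli could
  be glued to a single one for which the improper integral diverges.
\<close>

lemma uniform_tail_bound:
  fixes w :: "real \<Rightarrow> 'a"
  assumes w: "locally_piecewise_continuous UNIV norm w"
    and int: "\<And>\<phi>. \<phi> \<in> unit_functions \<Longrightarrow> improper_integrable (\<lambda>t. sc (\<phi> t) (w t))"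
  obtains R0 where "0 \<le> R0" "\<And>\<phi> R. \<phi> \<in> unit_functions \<Longrightarrow> R0 \<le> R \<Longrightarrow>
    norm (integral {-R..R} (\<lambda>t. sc (\<phi> t) (w t)) - integral {-R0..R0} (\<lambda>t. sc (\<phi> t) (w t))) \<le> 1"
proof (rule ccontr)
  define F where "F \<phi> R = integral {-R..R} (\<lambda>t. sc (\<phi> t) (w t))" for \<phi> R
  assume "\<not> thesis"
  then have "\<forall>R0\<ge>0. \<exists>\<phi>\<in>unit_functions. \<exists>R\<ge>R0. norm (F \<phi> R - F \<phi> R0) > 1"
    using that unfolding F_def by (metis linorder_not_less)
  then obtain P Q where P: "\<And>R. 0 \<le> R \<Longrightarrow> P R \<in> unit_functions"
    and Q: "\<And>R. 0 \<le> R \<Longrightarrow> R \<le> Q R"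
    and PQ: "\<And>R. 0 \<le> R \<Longrightarrow> norm (F (P R) (Q R) - F (P R) R) > 1"
    by metis
  \<comment> \<open>The n-th hump lives on the annulus from \<open>T n + 1\<close> to
    \<open>T (Suc n)\<close>. The gap of length 1 forces \<open>T\<close> to infinity, since
    \<open>Q R\<close> is only known to be at least R, and it keeps the closed annulus outside the
    ball where the earlier multiplier is retained.\<close>
  define T where "T = rec_nat 0 (\<lambda>_ x. Q (x + 1))"
  have T_simps: "T 0 = 0" "T (Suc n) = Q (T n + 1)" for n by (simp_all add: T_def)
  have T_nonneg: "0 \<le> T n" for n
  proof (induction n)
    case (Suc n)
    then show ?case using Q[of "T n + 1"] by (simp add: T_simps)
  qed (simp add: T_simps)
  have T_step: "T n + 1 \<le> T (Suc n)" for n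
    using Q[of "T n + 1"] T_nonneg[of n] by (simp add: T_simps)
  have T_ge: "real n \<le> T n" for n
  proof (induction n)
    case (Suc n) then show ?case using T_step[of n] by simp
  qed (simp add: T_simps)
  \<comment> \<open>Passing to the next stage changes the multiplier only outside the ball of radius
    \<open>T n\<close>, so the values on each ball stabilise.\<close>
  define \<psi> where "\<psi> = rec_nat (\<lambda>_. 0) (\<lambda>n f t. if \<bar>t\<bar> \<le> T n then f t else P (T n + 1) t)"
  have \<psi>_simps: "\<psi> 0 = (\<lambda>_. 0)" "\<psi> (Suc n) t = (if \<bar>t\<bar> \<le> T n then \<psi> n t else P (T n + 1) t)" for n t
    by (simp_all add: \<psi>_def)
  have \<psi>: "\<psi> n \<in> unit_functions" for n
  proof (induction n)
    case 0
    then show ?case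
      by (auto simp: \<psi>_simps unit_functions_def intro: locally_piecewise_continuous_const)
  next
    case (Suc n)
    have "\<psi> (Suc n) = (\<lambda>t. if \<bar>t\<bar> \<le> T n then \<psi> n t else P (T n + 1) t)"
      by (simp add: \<psi>_simps fun_eq_iff)
    then show ?case
      using Suc P[of "T n + 1"] T_nonneg[of n]
      by (auto simp: unit_functions_def intro: locally_piecewise_continuous_if_cball)
  qed
  have stable: "\<psi> m t = \<psi> n t" if "n \<le> m" "\<bar>t\<bar> \<le> T n" for m n t
    using that(1)
  proof (induction rule: dec_induct)
    case (step m)
    have "T n \<le> T m" using step(1)
      by (rule lift_Suc_mono_le[rotated]) (use T_step in \<open>smt (verit)\<close>)
    then show ?case using step that(2) by (simp add: \<psi>_simps)
  qed simp
  \<comment> \<open>The stable value at t: the index chosen is at least |t|, and \<open>T n\<close>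
    is at least n, so t already lies in the ball where this stage is final.\<close>
  define \<phi> where "\<phi> t = \<psi> (nat \<lceil>\<bar>t\<bar>\<rceil>) t" for t
  have \<phi>_eq: "\<phi> t = \<psi> n t" if "\<bar>t\<bar> \<le> T n" for t n
  proof -
    have "\<bar>t\<bar> \<le> T (nat \<lceil>\<bar>t\<bar>\<rceil>)" using T_ge[of "nat \<lceil>\<bar>t\<bar>\<rceil>"] by linarith
    then show ?thesis
      using that stable[of n "nat \<lceil>\<bar>t\<bar>\<rceil>" t] stable[of "nat \<lceil>\<bar>t\<bar>\<rceil>" n t]
      unfolding \<phi>_def by (metis nle_le)
  qed
  have "\<exists>g. locally_piecewise_continuous UNIV norm g \<and> eventually (\<lambda>s. \<phi> s = g s) (nhds t)" for t
  proof -
    obtain n where n: "\<bar>t\<bar> < real n" using reals_Archimedean2 by blast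
    have "eventually (\<lambda>s. s \<in> {- real n<..<real n}) (nhds t)"
      using n by (intro eventually_nhds_in_open) auto
    then have "eventually (\<lambda>s. \<phi> s = \<psi> n s) (nhds t)"
      by eventually_elim (rule \<phi>_eq, use T_ge[of n] in auto)
    with \<psi>[of n] show ?thesis unfolding unit_functions_def by blast
  qed
  then have "\<exists>g. locally_piecewise_continuous UNIV norm g \<and> eventually (\<lambda>s. \<phi> s = g s) (at_left t)"
    "\<exists>g. locally_piecewise_continuous UNIV norm g \<and> eventually (\<lambda>s. \<phi> s = g s) (at_right t)" for t
    by (meson eventually_nhds_conv_at eventually_at_split)+
  then have "locally_piecewise_continuous UNIV norm \<phi>"
    by (rule locally_piecewise_continuous_cong_local[OF UNIV_I])
  then have \<phi>: "\<phi> \<in> unit_functions"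
    using \<psi> by (auto simp: unit_functions_def \<phi>_def)
  then obtain L where L: "(F \<phi> \<longlongrightarrow> L) at_top"
    using int unfolding improper_integrable_def F_def by blast
  have T_lim: "filterlim T at_top sequentially"
    using T_ge by (intro filterlim_at_top_mono[OF filterlim_real_sequentially]) auto
  have "((\<lambda>n. F \<phi> (T (Suc n))) \<longlongrightarrow> L) sequentially"
    by (rule filterlim_compose[OF L]) (use T_lim in \<open>simp add: filterlim_sequentially_Suc\<close>)
  moreover have "((\<lambda>n. F \<phi> (T n + 1)) \<longlongrightarrow> L) sequentially"
    by (rule filterlim_compose[OF L])
      (rule filterlim_at_top_mono[OF T_lim], auto)
  \<comment> \<open>Both radii of the n-th annulus tend to infinity, so convergence for \<phi> makes
    the increments over the annuli vanish. On the annulus \<phi> agrees with the violating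
    multiplier, whose increment exceeds 1.\<close>
  ultimately have "((\<lambda>n. F \<phi> (T (Suc n)) - F \<phi> (T n + 1)) \<longlongrightarrow> L - L) sequentially"
    by (rule tendsto_diff)
  then have "eventually (\<lambda>n. norm (F \<phi> (T (Suc n)) - F \<phi> (T n + 1)) < 1) sequentially"
    by (intro order_tendstoD(2)[OF tendsto_norm_zero]) simp_all
  then obtain n where n: "norm (F \<phi> (T (Suc n)) - F \<phi> (T n + 1)) < 1"
    by (auto simp: eventually_sequentially)
  let ?p = "P (T n + 1)"
  have eq: "\<phi> t = ?p t" if "T n + 1 \<le> \<bar>t\<bar>" "\<bar>t\<bar> \<le> T (Suc n)" for t
    using that by (simp add: \<phi>_eq[of _ "Suc n"] \<psi>_simps)
  have diff: "F f (T (Suc n)) - F f (T n + 1) =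
      integral {- T (Suc n)..- (T n + 1)} (\<lambda>t. sc (f t) (w t)) +
      integral {T n + 1..T (Suc n)} (\<lambda>t. sc (f t) (w t))" if "f \<in> unit_functions" for f
    unfolding F_def
    by (rule integral_symmetric_diff[OF scale_integrable[OF that w]])
      (use T_nonneg[of n] T_step[of n] in auto)
  have p: "?p \<in> unit_functions" using P T_nonneg[of n] by simp
  have "F \<phi> (T (Suc n)) - F \<phi> (T n + 1) = F ?p (T (Suc n)) - F ?p (T n + 1)"
    unfolding diff[OF \<phi>] diff[OF p]
    using T_nonneg[of n] by (intro arg_cong2[of _ _ _ _ "(+)"] integral_cong) (auto simp: eq)
  then show False using n PQ[of "T n + 1"] T_nonneg[of n] by (simp add: T_simps)
qed

lemma improper_integral_tendsto:
  assumes "improper_integrable g"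
  shows "((\<lambda>R. integral {-R..R} g) \<longlongrightarrow> improper_integral g) at_top"
  using assms unfolding improper_integrable_def improper_integral_def
  by (auto simp: tendsto_Lim)

text \<open>The tail beyond R0 contributes at most 1 for every multiplier, and the part inside at
  most the integral of the norm of w. This is the finiteness that makes the supremum in
  \<open>cont_J_norm\<close> an upper bound.\<close>

lemma bdd_above_improper_integrals:
  fixes w :: "real \<Rightarrow> 'a"
  assumes w: "locally_piecewise_continuous UNIV norm w"
    and int: "\<And>\<phi>. \<phi> \<in> unit_functions \<Longrightarrow> improper_integrable (\<lambda>t. sc (\<phi> t) (w t))"
  shows "bdd_above {norm (improper_integral (\<lambda>t. sc (\<phi> t) (w t))) | \<phi>. \<phi> \<in> unit_functions}"
proof -
  obtain R0 where R0: "0 \<le> R0" "\<And>\<phi> R. \<phi> \<in> unit_functions \<Longrightarrow> R0 \<le> R \<Longrightarrow>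
    norm (integral {-R..R} (\<lambda>t. sc (\<phi> t) (w t)) - integral {-R0..R0} (\<lambda>t. sc (\<phi> t) (w t))) \<le> 1"
    using uniform_tail_bound[OF assms] by blast
  have "norm (improper_integral (\<lambda>t. sc (\<phi> t) (w t))) \<le> 1 + integral {-R0..R0} (\<lambda>t. norm (w t))"
    if \<phi>: "\<phi> \<in> unit_functions" for \<phi>
  proof (rule Lim_norm_ubound[OF _ improper_integral_tendsto[OF int[OF \<phi>]]])
    have "norm (integral {-R0..R0} (\<lambda>t. sc (\<phi> t) (w t))) \<le> integral {-R0..R0} (\<lambda>t. norm (w t))"
    proof (rule integral_norm_bound_integral)
      show "(\<lambda>t. sc (\<phi> t) (w t)) integrable_on {-R0..R0}" using scale_integrable[OF \<phi> w] .
      show "(\<lambda>t. norm (w t)) integrable_on {-R0..R0}"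
        by (intro locally_piecewise_continuous_integrable locally_piecewise_continuous_norm w)
      show "norm (sc (\<phi> t) (w t)) \<le> norm (w t)" for t
        using \<phi> by (simp add: norm_scale unit_functions_def mult_left_le_one_le)
    qed
    then show "\<forall>\<^sub>F R in at_top. norm (integral {-R..R} (\<lambda>t. sc (\<phi> t) (w t)))
        \<le> 1 + integral {-R0..R0} (\<lambda>t. norm (w t))"
      using R0(2)[OF \<phi>]
      by (intro eventually_at_top_linorderI[of R0]) (smt (verit) norm_triangle_sub)
  qed simp
  then show ?thesis by (intro bdd_aboveI[of _ "1 + integral {-R0..R0} (\<lambda>t. norm (w t))"]) auto
qed

end

section \<open>Passing between functions and sequences\<close>

definition node :: "real \<Rightarrow> int \<Rightarrow> real" where
  "node r n = (of_int n - 1/2) * r"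

text \<open>The floor makes cells closed on the left and open on the right. At a right endpoint the
  index is already the next one, so integrals over closed cells are identified only after discarding
  one point.\<close>

definition cell :: "real \<Rightarrow> real \<Rightarrow> int" where
  "cell r t = \<lfloor>t / r + 1/2\<rfloor>"

lemma cell_eq:
  assumes "r > 0" "node r n \<le> t" "t < node r (n + 1)"
  shows "cell r t = n"
  using assms unfolding cell_def node_def floor_eq_iff by (auto simp: field_simps)

lemma node_cell:
  assumes "r > 0"
  shows "node r (cell r t) \<le> t" "t < node r (cell r t + 1)"
proof -
  have "of_int (cell r t) \<le> t / r + 1/2" "t / r + 1/2 < of_int (cell r t) + 1"
    unfolding cell_def by linarith+
  then show "node r (cell r t) \<le> t" "t < node r (cell r t + 1)"
    using assms by (simp_all add: node_def field_simps)
qed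

lemma node_Suc: "node r (n + 1) = node r n + r"
  by (simp add: node_def algebra_simps)

lemma node_uminus: "node r (- n) = - node r (n + 1)"
  by (simp add: node_def algebra_simps)

lemma node_pos: "r > 0 \<Longrightarrow> node r (int N + 1) > 0"
  by (simp add: node_def)

lemma filterlim_node: "r > 0 \<Longrightarrow> filterlim (\<lambda>N. node r (int N + 1)) at_top sequentially"
proof -
  assume r: "r > 0"
  have "filterlim (\<lambda>N. r * real N) at_top sequentially"
    by (rule filterlim_tendsto_pos_mult_at_top[OF tendsto_const r filterlim_real_sequentially])
  then show ?thesis
    by (rule filterlim_at_top_mono) (use r in \<open>simp add: node_def algebra_simps\<close>)
qed

text \<open>A point of a cell is within r/2 of its centre; the bound by r used here is coarser but
  sufficient. The two inequalities serve the two directions of replacing one weight by the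
  other.\<close>

lemma exp_node_le:
  assumes "r > 0" "\<bar>c\<bar> \<le> 1" "node r n \<le> t" "t \<le> node r (n + 1)"
  shows "exp (c * (t - r * of_int n)) \<le> exp r" "exp (c * (r * of_int n - t)) \<le> exp r"
proof -
  have "\<bar>t - r * of_int n\<bar> \<le> r"
    using assms by (simp add: node_def abs_le_iff algebra_simps)
  then have "\<bar>c * (t - r * of_int n)\<bar> \<le> r"
    using assms(2) by (simp add: abs_mult mult_left_le_one_le mult_le_one order_trans[OF mult_left_le_one_le])
  then show "exp (c * (t - r * of_int n)) \<le> exp r" "exp (c * (r * of_int n - t)) \<le> exp r"
    by (auto simp: abs_le_iff algebra_simps)
qed

lemma locally_piecewise_continuous_cell:
  assumes "r > 0" "N 0 = 0" "\<And>n. v n \<in> C"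
  shows "locally_piecewise_continuous C N (\<lambda>t. v (cell r t))"
proof (rule locally_piecewise_continuous_cong_local)
  fix t
  \<comment> \<open>Ceiling minus one, and not the floor of \<open>cell\<close>: when t is a node,
    the left germ belongs to the preceding cell.\<close>
  define n where "n = \<lceil>t / r + 1/2\<rceil> - 1"
  have "of_int n < t / r + 1/2" "t / r + 1/2 \<le> of_int n + 1"
    unfolding n_def by linarith+
  then have n: "node r n < t" "t \<le> node r (n + 1)"
    using assms(1) by (simp_all add: node_def field_simps)
  have "eventually (\<lambda>s. v (cell r s) = v n) (at_left t)"
    using eventually_at_left_real[OF n(1)]
    by eventually_elim (use n(2) in \<open>auto intro!: arg_cong[of _ _ v] cell_eq[OF assms(1)]\<close>)
  then show "\<exists>g. locally_piecewise_continuous C N g \<and> eventually (\<lambda>s. v (cell r s) = g s) (at_left t)"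
    using locally_piecewise_continuous_const[of "v n" C N] assms(2,3) by blast
  note m = node_cell[OF assms(1), of t]
  have "eventually (\<lambda>s. v (cell r s) = v (cell r t)) (at_right t)"
    using eventually_at_right_real[OF m(2)]
    by eventually_elim (use m(1) in \<open>auto intro!: arg_cong[of _ _ v] cell_eq[OF assms(1)]\<close>)
  then show "\<exists>g. locally_piecewise_continuous C N g \<and> eventually (\<lambda>s. v (cell r s) = g s) (at_right t)"
    using locally_piecewise_continuous_const[of "v (cell r t)" C N] assms(2,3) by blast
qed (rule assms)

lemma integral_nodes:
  fixes f :: "real \<Rightarrow> 'a :: banach"
  assumes f: "\<And>a b. f integrable_on {a..b}" and r: "r > 0"
  shows "integral {- node r (int N + 1)..node r (int N + 1)} f =
    (\<Sum>n = - int N..int N. integral {node r n..node r (n + 1)} f)"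
proof (induction N)
  case 0
  then show ?case by (simp add: node_def)
next
  case (Suc N)
  have "integral {- node r (int (Suc N) + 1)..node r (int (Suc N) + 1)} f =
     integral {- node r (int N + 1)..node r (int N + 1)} f +
     (integral {node r (- int (Suc N))..node r (- int (Suc N) + 1)} f +
      integral {node r (int (Suc N))..node r (int (Suc N) + 1)} f)"
  proof -
    have "node r (- int (Suc N)) = - node r (int (Suc N) + 1)"
      "node r (- int (Suc N) + 1) = - node r (int N + 1)" "int (Suc N) = int N + 1"
      by (simp_all add: node_def algebra_simps)
    moreover have "node r (int N + 1) \<le> node r (int (Suc N) + 1)"
      using r by (simp add: node_def)
    ultimately show ?thesis
      using integral_symmetric_diff[OF f, of "node r (int N + 1)" "node r (int (Suc N) + 1)"]
        node_pos[OF r, of N]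
      by (simp only: diff_eq_eq) (simp add: ac_simps)
  qed
  moreover have "{- int (Suc N)..int (Suc N)} = insert (- int (Suc N)) (insert (int (Suc N)) {- int N..int N})"
    by auto
  ultimately show ?case using Suc by (simp add: algebra_simps)
qed

text \<open>A radius inside the N-th cell differs from the next node by pieces whose effect is at
  most \<open>e N\<close>. The index of the cell containing R tends to infinity with R, so nodal
  convergence becomes convergence over all radii.\<close>

lemma tendsto_at_top_from_nodes:
  fixes F :: "real \<Rightarrow> 'a :: real_normed_vector"
  assumes r: "r > 0" and F: "(\<lambda>N. F (node r (int N + 1))) \<longlonglongrightarrow> L" and e: "e \<longlonglongrightarrow> 0"
    and le: "\<And>N R. 0 \<le> R \<Longrightarrow> node r (int N) \<le> R \<Longrightarrow> R \<le> node r (int N + 1) \<Longrightarrow>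
      norm (F R - F (node r (int N + 1))) \<le> e N"
  shows "(F \<longlongrightarrow> L) at_top"
proof -
  define M where "M R = nat (cell r R)" for R
  have M: "filterlim M at_top at_top"
    unfolding filterlim_at_top
  proof
    fix K
    show "eventually (\<lambda>R. K \<le> M R) at_top"
    proof (rule eventually_at_top_linorderI)
      fix R assume "real K * r \<le> R"
      then have "real K \<le> R / r" using r by (simp add: field_simps)
      then show "K \<le> M R" unfolding M_def cell_def by linarith
    qed
  qed
  have "eventually (\<lambda>R. norm (F R - F (node r (int (M R) + 1))) \<le> e (M R)) at_top"
    using eventually_ge_at_top[of 0]
  proof eventually_elim
    case (elim R)
    then have "0 \<le> cell r R" using r by (simp add: cell_def)
    then have "int (M R) = cell r R" by (simp add: M_def)
    then show ?case using elim node_cell[OF r, of R] by (intro le) auto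
  qed
  moreover have "((\<lambda>R. e (M R)) \<longlongrightarrow> 0) at_top" by (rule filterlim_compose[OF e M])
  ultimately have "((\<lambda>R. F R - F (node r (int (M R) + 1))) \<longlongrightarrow> 0) at_top"
    by (rule Lim_null_comparison)
  from tendsto_add[OF this filterlim_compose[OF F M]] show ?thesis by simp
qed

lemma integral_cell:
  fixes v :: "int \<Rightarrow> 'a :: banach"
  assumes "r > 0" "node r n \<le> a" "a \<le> b" "b \<le> node r (n + 1)"
  shows "integral {a..b} (\<lambda>t. v (cell r t)) = (b - a) *\<^sub>R v n"
proof -
  have "integral {a..b} (\<lambda>t. v (cell r t)) = integral {a..b} (\<lambda>t. v n)"
  proof (rule integral_spike[of "{b}"])
    fix t assume "t \<in> {a..b} - {b}"
    then show "v n = v (cell r t)" using assms cell_eq[of r n t] by simp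
  qed simp
  then show ?thesis using assms by simp
qed

section \<open>Moving weights into multipliers, for integrals and for sums\<close>

context banach_space_over
begin

text \<open>The discrete weight times l(n) equals the continuous weight times a function that on
  cell n is l(n) multiplied by the ratio of the weights. That function is bounded by M exp r;
  dividing by this constant makes it an admissible multiplier, and the constant reappears in
  front.\<close>

lemma discretize_multiplier:
  fixes g :: "real \<Rightarrow> 'a" and l :: "int \<Rightarrow> 'f"
  assumes g: "locally_piecewise_continuous UNIV norm g"
    and r: "r > 0" and c: "\<bar>c\<bar> \<le> 1" and M: "M > 0" and l: "\<And>n. norm (l n) \<le> M"
  shows "\<exists>\<phi>\<in>unit_functions. \<forall>N. (\<Sum>n = - int N..int N.
        sc (l n) (exp (c * r * of_int n) *\<^sub>R integral {node r n..node r (n + 1)} g)) =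
      (M * exp r) *\<^sub>R integral {- node r (int N + 1)..node r (int N + 1)}
        (\<lambda>t. sc (\<phi> t) (exp (c * t) *\<^sub>R g t))"
proof -
  define \<phi> where "\<phi> t = (exp (- (c * t)) / (M * exp r)) *\<^sub>R (exp (c * r * of_int (cell r t)) *\<^sub>R l (cell r t))" for t
  have "locally_piecewise_continuous UNIV norm \<phi>"
    unfolding \<phi>_def
    by (intro locally_piecewise_continuous_bilinear[OF bounded_bilinear_scaleR]
        locally_piecewise_continuous_continuous continuous_intros
        locally_piecewise_continuous_cell[OF r, where v = "\<lambda>n. exp (c * r * of_int n) *\<^sub>R l n"])
      (use M in auto)
  moreover have "norm (\<phi> t) \<le> 1" for t
  proof -
    have "exp (- (c * t)) * exp (c * r * of_int (cell r t)) = exp (c * (r * of_int (cell r t) - t))"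
      by (simp add: algebra_simps flip: exp_add)
    also have "\<dots> \<le> exp r"
      using node_cell[OF r, of t] by (intro exp_node_le[OF r c]) auto
    finally have "exp (- (c * t)) * exp (c * r * of_int (cell r t)) * norm (l (cell r t)) \<le> exp r * M"
      by (intro mult_mono l) auto
    then show ?thesis using M by (simp add: \<phi>_def field_simps)
  qed
  ultimately have \<phi>: "\<phi> \<in> unit_functions" by (simp add: unit_functions_def)
  have w: "locally_piecewise_continuous UNIV norm (\<lambda>t. exp (c * t) *\<^sub>R g t)"
    by (intro locally_piecewise_continuous_bilinear[OF bounded_bilinear_scaleR] g
        locally_piecewise_continuous_continuous continuous_intros)
  interpret S: bounded_bilinear sc by (rule bounded_bilinear_scale)
  have piece: "sc (l n) (exp (c * r * of_int n) *\<^sub>R integral {node r n..node r (n + 1)} g) =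
     (M * exp r) *\<^sub>R integral {node r n..node r (n + 1)} (\<lambda>t. sc (\<phi> t) (exp (c * t) *\<^sub>R g t))" for n
  proof -
    have "integral {node r n..node r (n + 1)} (\<lambda>t. sc (\<phi> t) (exp (c * t) *\<^sub>R g t)) =
      integral {node r n..node r (n + 1)} (\<lambda>t. sc ((exp (c * r * of_int n) / (M * exp r)) *\<^sub>R l n) (g t))"
    proof (rule integral_spike[of "{node r (n + 1)}"])
      fix t assume "t \<in> {node r n..node r (n + 1)} - {node r (n + 1)}"
      then have "cell r t = n" by (intro cell_eq[OF r]) auto
      moreover have "exp (c * t) * exp (- (c * t)) = 1" by (simp flip: exp_add)
      ultimately show "sc ((exp (c * r * of_int n) / (M * exp r)) *\<^sub>R l n) (g t) =
          sc (\<phi> t) (exp (c * t) *\<^sub>R g t)"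
        by (simp add: \<phi>_def scale_scaleR)
    qed simp
    also have "\<dots> = sc ((exp (c * r * of_int n) / (M * exp r)) *\<^sub>R l n) (integral {node r n..node r (n + 1)} g)"
      using integral_linear[OF locally_piecewise_continuous_integrable[OF g] S.bounded_linear_right]
      by (simp add: o_def)
    finally show ?thesis using M by (simp add: scale_scaleR)
  qed
  have "(\<Sum>n = - int N..int N.
        sc (l n) (exp (c * r * of_int n) *\<^sub>R integral {node r n..node r (n + 1)} g)) =
      (M * exp r) *\<^sub>R integral {- node r (int N + 1)..node r (int N + 1)}
        (\<lambda>t. sc (\<phi> t) (exp (c * t) *\<^sub>R g t))" for N
    unfolding integral_nodes[OF scale_integrable[OF \<phi> w] r] piece scaleR_sum_right ..
  with \<phi> show ?thesis by blast
qed

text \<open>Nodal radii form a sequence tending to infinity, so the limit of the integrals is the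
  limit of the partial sums. Arbitrary M gives unconditional convergence, which tests all bounded
  sequences; M = 1 gives the comparison of norms.\<close>

lemma discretize:
  fixes g :: "real \<Rightarrow> 'a"
  assumes g: "locally_piecewise_continuous UNIV norm g" and r: "r > 0" and c: "\<bar>c\<bar> \<le> 1"
    and int: "\<And>\<phi>. \<phi> \<in> unit_functions \<Longrightarrow> improper_integrable (\<lambda>t. sc (\<phi> t) (exp (c * t) *\<^sub>R g t))"
  defines "y \<equiv> \<lambda>n. exp (c * r * of_int n) *\<^sub>R integral {node r n..node r (n + 1)} g"
  shows "unconditionally_convergent sc y"
    and "l \<in> unit_sequences \<Longrightarrow> \<exists>\<phi>\<in>unit_functions. norm (bilateral_sum (\<lambda>n. sc (l n) (y n))) =
      exp r * norm (improper_integral (\<lambda>t. sc (\<phi> t) (exp (c * t) *\<^sub>R g t)))"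
proof -
  have lim: "\<exists>\<phi>\<in>unit_functions. (\<lambda>N. \<Sum>n = - int N..int N. sc (l n) (y n)) \<longlonglongrightarrow>
      (M * exp r) *\<^sub>R improper_integral (\<lambda>t. sc (\<phi> t) (exp (c * t) *\<^sub>R g t))"
    if M: "M > 0" "\<And>n. norm (l n) \<le> M" for M l
  proof -
    obtain \<phi> where \<phi>: "\<phi> \<in> unit_functions"
      and eq: "\<And>N. (\<Sum>n = - int N..int N. sc (l n) (y n)) =
      (M * exp r) *\<^sub>R integral {- node r (int N + 1)..node r (int N + 1)}
        (\<lambda>t. sc (\<phi> t) (exp (c * t) *\<^sub>R g t))"
      using discretize_multiplier[OF g r c M(1), of l, OF M(2)] unfolding y_def by metis
    show ?thesis
      unfolding eq
      by (intro bexI[OF _ \<phi>] tendsto_scaleR tendsto_const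
          filterlim_compose[OF improper_integral_tendsto[OF int[OF \<phi>]] filterlim_node[OF r]])
  qed
  show "unconditionally_convergent sc y"
    unfolding unconditionally_convergent_def
  proof (intro allI impI)
    fix l :: "int \<Rightarrow> 'f" assume "bounded (range l)"
    then obtain M where "M > 0" "\<And>n. norm (l n) \<le> M" by (auto simp: bounded_pos)
    then show "convergent (\<lambda>N. \<Sum>n = - int N..int N. sc (l n) (y n))"
      using lim unfolding convergent_def by blast
  qed
  show "\<exists>\<phi>\<in>unit_functions. norm (bilateral_sum (\<lambda>n. sc (l n) (y n))) =
      exp r * norm (improper_integral (\<lambda>t. sc (\<phi> t) (exp (c * t) *\<^sub>R g t)))"
    if l: "l \<in> unit_sequences"
  proof -
    obtain \<phi> where \<phi>: "\<phi> \<in> unit_functions" and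
      "(\<lambda>N. \<Sum>n = - int N..int N. sc (l n) (y n)) \<longlonglongrightarrow>
        (1 * exp r) *\<^sub>R improper_integral (\<lambda>t. sc (\<phi> t) (exp (c * t) *\<^sub>R g t))"
      using lim[OF zero_less_one, of l] l unfolding unit_sequences_def by blast
    then have "bilateral_sum (\<lambda>n. sc (l n) (y n)) =
        exp r *\<^sub>R improper_integral (\<lambda>t. sc (\<phi> t) (exp (c * t) *\<^sub>R g t))"
      unfolding bilateral_sum_def by (simp add: limI)
    then show ?thesis using \<phi> by (intro bexI[OF _ \<phi>]) simp
  qed
qed

text \<open>Symmetric partial sums add the terms at N + 1 and -(N + 1) together, and these might
  cancel. Multipliers that are 1 on one half of the integers and 0 on the other separate
  them.\<close>

lemma unconditionally_convergent_tendsto_0: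
  assumes "unconditionally_convergent sc y"
  shows "(\<lambda>N. y (int N)) \<longlonglongrightarrow> 0" "(\<lambda>N. y (- int N)) \<longlonglongrightarrow> 0"
proof -
  define S where "S P N = (\<Sum>n = - int N..int N. sc (if P n then 1 else 0) (y n))" for P N
  have S: "(\<lambda>N. S P (Suc N) - S P N) \<longlonglongrightarrow> 0" for P
  proof -
    have "bounded (range (\<lambda>n. if P n then 1 else 0 :: 'f))"
      by (rule boundedI[of _ 1]) auto
    then have "convergent (S P)"
      using assms unfolding unconditionally_convergent_def S_def by blast
    then obtain L where "S P \<longlonglongrightarrow> L" by (auto simp: convergent_def)
    from tendsto_diff[OF LIMSEQ_Suc[OF this] this] show ?thesis by simp
  qed
  have step: "S P (Suc N) - S P N =
      (if P (- int (Suc N)) then y (- int (Suc N)) else 0) + (if P (int (Suc N)) then y (int (Suc N)) else 0)" for P N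
  proof -
    have "{- int (Suc N)..int (Suc N)} = insert (- int (Suc N)) (insert (int (Suc N)) {- int N..int N})"
      by auto
    then show ?thesis by (simp add: S_def)
  qed
  show "(\<lambda>N. y (int N)) \<longlonglongrightarrow> 0"
    using S[of "\<lambda>n. n \<ge> 0"] unfolding step by - (rule LIMSEQ_imp_Suc, simp)
  show "(\<lambda>N. y (- int N)) \<longlonglongrightarrow> 0"
    using S[of "\<lambda>n. n < 0"] unfolding step by - (rule LIMSEQ_imp_Suc, simp)
qed

text \<open>Each z(n) is spread with constant density over its cell, so on that cell only the scalar
  factor varies and can be integrated first. The resulting averages form a sequence in the unit
  ball, up to the factor exp r.\<close>

lemma continuize:
  fixes z :: "int \<Rightarrow> 'a"
  assumes r: "r > 0" and c: "\<bar>c\<bar> \<le> 1" and \<phi>: "\<phi> \<in> unit_functions"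
  defines "y \<equiv> \<lambda>n. exp (c * r * of_int n) *\<^sub>R z n"
  defines "h \<equiv> \<lambda>t. sc (\<phi> t) (exp (c * t) *\<^sub>R ((1 / r) *\<^sub>R z (cell r t)))"
  assumes uc: "unconditionally_convergent sc y"
  shows "improper_integrable h"
    and "\<exists>l\<in>unit_sequences. norm (improper_integral h) = exp r * norm (bilateral_sum (\<lambda>n. sc (l n) (y n)))"
proof -
  interpret S: bounded_bilinear sc by (rule bounded_bilinear_scale)
  have z: "locally_piecewise_continuous UNIV norm (\<lambda>t. exp (c * t) *\<^sub>R ((1 / r) *\<^sub>R z (cell r t)))"
    by (intro locally_piecewise_continuous_bilinear[OF bounded_bilinear_scaleR]
        locally_piecewise_continuous_continuous continuous_intros
        locally_piecewise_continuous_cell[OF r, where v = "\<lambda>n. (1 / r) *\<^sub>R z n"]) auto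
  have h_int: "h integrable_on {a..b}" for a b
    unfolding h_def by (rule scale_integrable[OF \<phi> z])
  have \<phi>1: "norm (\<phi> t) \<le> 1" for t using \<phi> by (simp add: unit_functions_def)
  have k: "locally_piecewise_continuous UNIV norm (\<lambda>t. exp (c * (t - d)) *\<^sub>R \<phi> t)" for d
    using \<phi>
    by (intro locally_piecewise_continuous_bilinear[OF bounded_bilinear_scaleR
          locally_piecewise_continuous_continuous] continuous_intros) (simp add: unit_functions_def)
  \<comment> \<open>The mean over cell n of \<phi> times the ratio of the weights, divided by exp r;
    the ratio is at most exp r, hence norm at most 1.\<close>
  define l :: "int \<Rightarrow> 'f" where "l n = (1 / (r * exp r)) *\<^sub>R
    integral {node r n..node r (n + 1)} (\<lambda>t. exp (c * (t - r * of_int n)) *\<^sub>R \<phi> t)" for n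
  have "norm (l n) \<le> 1" for n
  proof -
    have "norm (integral {node r n..node r (n + 1)} (\<lambda>t. exp (c * (t - r * of_int n)) *\<^sub>R \<phi> t))
        \<le> integral {node r n..node r (n + 1)} (\<lambda>t. exp r)"
    proof (rule integral_norm_bound_integral)
      show "norm (exp (c * (t - r * of_int n)) *\<^sub>R \<phi> t) \<le> exp r" if "t \<in> {node r n..node r (n + 1)}" for t
        using mult_mono[OF exp_node_le(1)[OF r c, of n t] \<phi>1[of t]] that by simp
    qed (auto intro: locally_piecewise_continuous_integrable[OF k])
    also have "\<dots> = r * exp r" using r by (simp add: node_Suc)
    finally show ?thesis using r by (simp add: l_def field_simps)
  qed
  then have l: "l \<in> unit_sequences" by (simp add: unit_sequences_def)
  have h_cell: "h t = sc (exp (c * (t - r * of_int n)) *\<^sub>R \<phi> t) ((1 / r) *\<^sub>R y n)" if "cell r t = n" for t n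
  proof -
    have "exp (c * (t - r * of_int n)) * exp (c * r * of_int n) = exp (c * t)"
      by (simp add: algebra_simps flip: exp_add)
    then show ?thesis using that by (simp add: h_def y_def scale_scaleR mult.commute)
  qed
  have h_piece: "integral {node r n..node r (n + 1)} h = exp r *\<^sub>R sc (l n) (y n)" for n
  proof -
    have "integral {node r n..node r (n + 1)} h =
      integral {node r n..node r (n + 1)} (\<lambda>t. sc (exp (c * (t - r * of_int n)) *\<^sub>R \<phi> t) ((1 / r) *\<^sub>R y n))"
      by (rule integral_spike[of "{node r (n + 1)}"]) (auto intro!: h_cell[symmetric] cell_eq[OF r])
    also have "\<dots> = sc (integral {node r n..node r (n + 1)} (\<lambda>t. exp (c * (t - r * of_int n)) *\<^sub>R \<phi> t)) ((1 / r) *\<^sub>R y n)"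
      using integral_linear[OF locally_piecewise_continuous_integrable[OF k] S.bounded_linear_left]
      by (simp add: o_def)
    finally show ?thesis using r by (simp add: l_def scale_scaleR)
  qed
  have "bounded (range l)"
    using l by (intro boundedI[of _ 1]) (auto simp: unit_sequences_def)
  then have "convergent (\<lambda>N. \<Sum>n = - int N..int N. sc (l n) (y n))"
    using uc by (auto simp: unconditionally_convergent_def)
  then have "(\<lambda>N. \<Sum>n = - int N..int N. sc (l n) (y n)) \<longlonglongrightarrow> bilateral_sum (\<lambda>n. sc (l n) (y n))"
    unfolding bilateral_sum_def by (simp add: convergent_LIMSEQ_iff)
  then have nodes: "(\<lambda>N. integral {- node r (int N + 1)..node r (int N + 1)} h) \<longlonglongrightarrow>
      exp r *\<^sub>R bilateral_sum (\<lambda>n. sc (l n) (y n))"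
    unfolding integral_nodes[OF h_int r] h_piece scaleR_sum_right[symmetric]
    by (intro tendsto_scaleR tendsto_const)
  \<comment> \<open>A partially covered cell costs no more than a full one. Since the terms of y
    tend to 0, this handles radii between nodes.\<close>
  have part: "norm (integral {a..b} h) \<le> exp r * norm (y n)"
    if "node r n \<le> a" "a \<le> b" "b \<le> node r (n + 1)" for a b n
  proof -
    have "norm (integral {a..b} h) \<le> exp r * norm (y n) / r * measure lborel (cbox a b)"
    proof (rule has_integral_bound_spike_finite[of _ "{b}"])
      show "(h has_integral integral {a..b} h) (cbox a b)"
        using h_int[of a b] by (simp add: integrable_integral)
      fix t assume "t \<in> cbox a b - {b}"
      then have t: "node r n \<le> t" "t < node r (n + 1)" using that by auto
      have "norm (h t) = (exp (c * (t - r * of_int n)) * norm (\<phi> t)) * norm (y n) / r"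
        using r by (simp add: h_cell[OF cell_eq[OF r t]] norm_scale)
      also have "\<dots> \<le> (exp r * 1) * norm (y n) / r"
        using r t by (intro divide_right_mono mult_right_mono mult_mono exp_node_le[OF r c] \<phi>1) auto
      finally show "norm (h t) \<le> exp r * norm (y n) / r" by simp
    qed (use r in auto)
    also have "\<dots> \<le> exp r * norm (y n) / r * r"
      using that r by (intro mult_left_mono) (auto simp: node_Suc)
    finally show ?thesis using r by simp
  qed
  have "((\<lambda>R. integral {-R..R} h) \<longlongrightarrow> exp r *\<^sub>R bilateral_sum (\<lambda>n. sc (l n) (y n))) at_top"
  proof (rule tendsto_at_top_from_nodes[OF r nodes])
    show "(\<lambda>N. exp r * norm (y (- int N)) + exp r * norm (y (int N))) \<longlonglongrightarrow> 0"
      using unconditionally_convergent_tendsto_0[OF uc]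
      by (auto intro!: tendsto_eq_intros)
    fix N R
    assume R: "0 \<le> R" "node r (int N) \<le> R" "R \<le> node r (int N + 1)"
    have "norm (integral {-R..R} h - integral {- node r (int N + 1)..node r (int N + 1)} h) =
      norm (integral {- node r (int N + 1)..-R} h + integral {R..node r (int N + 1)} h)"
      by (subst norm_minus_commute) (simp add: integral_symmetric_diff[OF h_int R(1,3)])
    \<comment> \<open>By the symmetry of the nodes the left piece lies in cell -N and the right
      piece in cell N.\<close>
    also have "\<dots> \<le> exp r * norm (y (- int N)) + exp r * norm (y (int N))"
      using R node_uminus[of r "int N"] node_uminus[of r "int N - 1"]
      by (intro norm_triangle_mono part) auto
    finally show "norm (integral {-R..R} h - integral {- node r (int N + 1)..node r (int N + 1)} h)
      \<le> exp r * norm (y (- int N)) + exp r * norm (y (int N))" .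
  qed
  then have "improper_integrable h" "improper_integral h = exp r *\<^sub>R bilateral_sum (\<lambda>n. sc (l n) (y n))"
    by (auto simp: improper_integrable_def improper_integral_def tendsto_Lim)
  then show "improper_integrable h"
    and "\<exists>l\<in>unit_sequences. norm (improper_integral h) = exp r * norm (bilateral_sum (\<lambda>n. sc (l n) (y n)))"
    using l by auto
qed

text \<open>No second gliding hump: the step function built from z has uniformly bounded improper
  integrals, and its integrals over the cells give back z, so \<open>discretize\<close> turns that
  bound into one for the sums.\<close>

lemma bdd_above_bilateral_sums:
  fixes z :: "int \<Rightarrow> 'a"
  assumes r: "r > 0" and c: "\<bar>c\<bar> \<le> 1"
    and uc: "unconditionally_convergent sc (\<lambda>n. exp (c * r * of_int n) *\<^sub>R z n)"
  shows "bdd_above {norm (bilateral_sum (\<lambda>n. sc (l n) (exp (c * r * of_int n) *\<^sub>R z n))) | l. l \<in> unit_sequences}"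
proof -
  define g where "g t = (1 / r) *\<^sub>R z (cell r t)" for t
  have g: "locally_piecewise_continuous UNIV norm g"
    unfolding g_def
    by (rule locally_piecewise_continuous_cell[OF r, where v = "\<lambda>n. (1 / r) *\<^sub>R z n"]) auto
  have int: "improper_integrable (\<lambda>t. sc (\<phi> t) (exp (c * t) *\<^sub>R g t))" if "\<phi> \<in> unit_functions" for \<phi>
    unfolding g_def by (rule continuize(1)[OF r c that uc])
  have zg: "integral {node r n..node r (n + 1)} g = z n" for n
    unfolding g_def using integral_cell[OF r, of n _ _ "\<lambda>n. (1 / r) *\<^sub>R z n"] r by (simp add: node_Suc)
  have "locally_piecewise_continuous UNIV norm (\<lambda>t. exp (c * t) *\<^sub>R g t)"
    by (intro locally_piecewise_continuous_bilinear[OF bounded_bilinear_scaleR] g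
        locally_piecewise_continuous_continuous continuous_intros)
  from bdd_above_improper_integrals[OF this int]
  obtain B where B: "\<And>\<phi>. \<phi> \<in> unit_functions \<Longrightarrow>
      norm (improper_integral (\<lambda>t. sc (\<phi> t) (exp (c * t) *\<^sub>R g t))) \<le> B"
    unfolding bdd_above_def by blast
  show ?thesis
  proof (rule bdd_aboveI[of _ "exp r * B"], clarify)
    fix l :: "int \<Rightarrow> 'f" assume "l \<in> unit_sequences"
    from discretize(2)[OF g r c int this] B
    show "norm (bilateral_sum (\<lambda>n. sc (l n) (exp (c * r * of_int n) *\<^sub>R z n))) \<le> exp r * B"
      unfolding zg by auto
  qed
qed

end

section \<open>Banach couples\<close>

text \<open>Riemann sums are linear combinations of values of f, hence stay in D, and they
  approximate the integral.\<close>

lemma integral_in_closed_subspace: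
  fixes f :: "real \<Rightarrow> 'a :: banach"
  assumes f: "f integrable_on {a..b}" and D: "closed D" "subspace D" and fD: "\<And>t. f t \<in> D"
  shows "integral {a..b} f \<in> D"
proof -
  have "\<exists>y\<in>D. dist y (integral {a..b} f) < e" if e: "e > 0" for e
  proof -
    obtain \<gamma> where "gauge \<gamma>" and \<gamma>: "\<And>p. p tagged_division_of {a..b} \<Longrightarrow> \<gamma> fine p \<Longrightarrow>
        norm ((\<Sum>(x, k)\<in>p. measure lborel k *\<^sub>R f x) - integral {a..b} f) < e"
      using iffD1[OF has_integral_real integrable_integral[OF f], rule_format, OF e] by metis
    then obtain p where p: "p tagged_division_of {a..b}" "\<gamma> fine p"
      using fine_division_exists_real by blast
    have "(\<Sum>(x, k)\<in>p. measure lborel k *\<^sub>R f x) \<in> D"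
      using fD by (intro subspace_sum[OF D(2)]) (auto intro: subspace_scale[OF D(2)])
    with \<gamma>[OF p] show ?thesis by (auto simp: dist_norm)
  qed
  then show ?thesis using closed_approachable[OF D(1)] by blast
qed

text \<open>Turns a comparison of single representations into one of interpolation norms; it is
  applied once in each direction.\<close>

lemma Inf_le_scaled_Inf:
  fixes f :: "'c \<Rightarrow> real" and g :: "'d \<Rightarrow> real"
  assumes "T \<noteq> {}" "K > 0" "\<And>x. x \<in> S \<Longrightarrow> 0 \<le> f x" "\<And>y. y \<in> T \<Longrightarrow> \<exists>x\<in>S. f x \<le> K * g y"
  shows "Inf (f ` S) \<le> K * Inf (g ` T)"
proof -
  have "Inf (f ` S) / K \<le> Inf (g ` T)"
  proof (rule cInf_greatest)
    fix b assume "b \<in> g ` T"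
    then obtain x y where "x \<in> S" "y \<in> T" "b = g y" "f x \<le> K * g y" using assms(4) by blast
    moreover have "Inf (f ` S) \<le> f x"
      using \<open>x \<in> S\<close> assms(3) by (intro cInf_lower bdd_belowI[of _ 0]) auto
    ultimately show "Inf (f ` S) / K \<le> b" using assms(2) by (simp add: field_simps)
  qed (use assms in simp)
  then show ?thesis using assms(2) by (simp add: field_simps)
qed

context banach_couple
begin

lemma scaleR_embedding:
  "i0 (\<rho> *\<^sub>R x) = sV (of_real \<rho>) (i0 x)" "i1 (\<rho> *\<^sub>R y) = sV (of_real \<rho>) (i1 y)"
  by (simp_all flip: A0.scale_of_real A1.scale_of_real add: i0.scale i1.scale)

lemma inv_i0 [simp]: "inv i0 (i0 x) = x"
  using inj_i0 by (rule inv_f_f)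

lemma inv_i1 [simp]: "inv i1 (i1 x) = x"
  using inj_i1 by (rule inv_f_f)

lemma inter_space_embed:
  assumes "v \<in> inter_space"
  shows "i0 (inv i0 v) = v" "i1 (inv i1 v) = v"
  using assms by (auto simp: inter_space_def f_inv_into_f)

lemma inter_norm_0: "inter_norm 0 = 0"
proof -
  have "inv i0 0 = 0" "inv i1 0 = 0"
    using inv_i0[of 0] inv_i1[of 0] by (simp_all add: i0.zero i1.zero)
  then show ?thesis by (simp add: inter_norm_def)
qed

text \<open>\<open>inv i0\<close> and \<open>inv i1\<close> are arbitrary outside the ranges of the
  embeddings, so they respect differences only for vectors of the intersection.\<close>

lemma inv_lipschitz:
  assumes "v \<in> inter_space" "w \<in> inter_space"
  shows "norm (inv i0 v - inv i0 w) \<le> inter_norm (v - w)"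
    and "norm (inv i1 v - inv i1 w) \<le> inter_norm (v - w)"
proof -
  have "i0 (inv i0 v - inv i0 w) = v - w" "i1 (inv i1 v - inv i1 w) = v - w"
    using assms by (simp_all add: i0.diff i1.diff inter_space_embed)
  then have "inv i0 (v - w) = inv i0 v - inv i0 w" "inv i1 (v - w) = inv i1 v - inv i1 w"
    by (metis inv_i0 inv_i1)+
  then show "norm (inv i0 v - inv i0 w) \<le> inter_norm (v - w)"
    "norm (inv i1 v - inv i1 w) \<le> inter_norm (v - w)"
    by (simp_all add: inter_norm_def)
qed

text \<open>Pairs with equal images form a real subspace of the product, closed because the
  embeddings are continuous and the common space is Hausdorff. The integral of the pair of functions
  therefore stays in it.\<close>

lemma integral_embeddings_eq:
  fixes g :: "real \<Rightarrow> 'a" and h :: "real \<Rightarrow> 'b"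
  assumes "\<And>t. i0 (g t) = i1 (h t)" "g integrable_on {a..b}" "h integrable_on {a..b}"
  shows "i0 (integral {a..b} g) = i1 (integral {a..b} h)"
proof -
  define D where "D = {p. i0 (fst p) = i1 (snd p)}"
  have hi: "((\<lambda>t. (g t, h t)) has_integral (integral {a..b} g, integral {a..b} h)) {a..b}"
  proof -
    have "bounded_linear (\<lambda>x :: 'a. (x, 0 :: 'b))" "bounded_linear (\<lambda>y :: 'b. (0 :: 'a, y))"
      by (intro bounded_linear_Pair bounded_linear_ident bounded_linear_zero)+
    from has_integral_add[OF has_integral_linear[OF integrable_integral[OF assms(2)] this(1)]
        has_integral_linear[OF integrable_integral[OF assms(3)] this(2)]]
    show ?thesis by (simp add: o_def)
  qed
  have "integral {a..b} (\<lambda>t. (g t, h t)) \<in> D"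
  proof (rule integral_in_closed_subspace)
    show "closed D"
      unfolding D_def
      by (intro closed_Collect_eq continuous_on_compose2[OF continuous_i0]
          continuous_on_compose2[OF continuous_i1] continuous_on_fst continuous_on_snd continuous_on_id) auto
    show "subspace D"
      by (auto simp: subspace_def D_def i0.zero i1.zero i0.add i1.add scaleR_embedding)
    show "(\<lambda>t. (g t, h t)) integrable_on {a..b}" using hi by (rule has_integral_integrable)
  qed (simp add: D_def assms)
  then show ?thesis using hi by (simp add: integral_unique D_def)
qed

text \<open>Every decomposition of v can be shifted by x and y; membership of v in the sum space
  ensures that there is one. It lets one error be measured in \<open>A\<^sub>0\<close> and another
  in \<open>A\<^sub>1\<close>.\<close>

lemma sum_norm_add_le:
  assumes "v \<in> sum_space"
  shows "sum_norm (v + (i0 x + i1 y)) \<le> sum_norm v + (norm x + norm y)"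
proof -
  have "sum_norm (v + (i0 x + i1 y)) - (norm x + norm y) \<le> norm p + norm q"
    if "v = i0 p + i1 q" for p q
  proof -
    have "sum_norm (v + (i0 x + i1 y)) \<le> norm (p + x) + norm (q + y)"
      unfolding sum_norm_def
    proof (rule cInf_lower)
      have "v + (i0 x + i1 y) = i0 (p + x) + i1 (q + y)" by (simp add: that i0.add i1.add)
      then show "norm (p + x) + norm (q + y) \<in>
          {norm xa + norm ya |xa ya. v + (i0 x + i1 y) = i0 xa + i1 ya}" by blast
      show "bdd_below {norm xa + norm ya |xa ya. v + (i0 x + i1 y) = i0 xa + i1 ya}"
        by (rule bdd_belowI[of _ 0]) auto
    qed
    then show ?thesis using norm_triangle_ineq[of p x] norm_triangle_ineq[of q y] by linarith
  qed
  then have "sum_norm (v + (i0 x + i1 y)) - (norm x + norm y) \<le> sum_norm v"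
    unfolding sum_norm_def[of v] using assms
    by (intro cInf_greatest) (auto simp: sum_space_def)
  then show ?thesis by linarith
qed

section \<open>The two \<open>J\<close>-norms as finite suprema\<close>

lemma cont_J_components:
  assumes "u \<in> cont_J \<theta>"
  shows "u t \<in> inter_space"
    and "locally_piecewise_continuous UNIV norm (\<lambda>t. inv i0 (u t))"
    and "locally_piecewise_continuous UNIV norm (\<lambda>t. inv i1 (u t))"
    and "\<phi> \<in> unit_functions \<Longrightarrow> improper_integrable (\<lambda>t. s0 (\<phi> t) (exp ((0 - \<theta>) * t) *\<^sub>R inv i0 (u t)))"
    and "\<phi> \<in> unit_functions \<Longrightarrow> improper_integrable (\<lambda>t. s1 (\<phi> t) (exp ((1 - \<theta>) * t) *\<^sub>R inv i1 (u t)))"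
proof -
  have u: "locally_piecewise_continuous inter_space inter_norm u" using assms by (simp add: cont_J_def)
  show "locally_piecewise_continuous UNIV norm (\<lambda>t. inv i0 (u t))"
    "locally_piecewise_continuous UNIV norm (\<lambda>t. inv i1 (u t))"
    by (rule locally_piecewise_continuous_comp[OF u], rule inv_lipschitz, assumption+)+
  show "u t \<in> inter_space" using u by (simp add: locally_piecewise_continuous_def)
  show "\<phi> \<in> unit_functions \<Longrightarrow> improper_integrable (\<lambda>t. s0 (\<phi> t) (exp ((0 - \<theta>) * t) *\<^sub>R inv i0 (u t)))"
    "\<phi> \<in> unit_functions \<Longrightarrow> improper_integrable (\<lambda>t. s1 (\<phi> t) (exp ((1 - \<theta>) * t) *\<^sub>R inv i1 (u t)))"
    using assms unfolding cont_J_def weighted_fun0_def weighted_fun1_def by blast+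
qed

lemma cont_J_norm_bound:
  assumes u: "u \<in> cont_J \<theta>" and \<phi>: "\<phi> \<in> unit_functions"
  shows "norm (improper_integral (\<lambda>t. s0 (\<phi> t) (weighted_fun0 \<theta> u t))) \<le> cont_J_norm \<theta> u"
    and "norm (improper_integral (\<lambda>t. s1 (\<phi> t) (weighted_fun1 \<theta> u t))) \<le> cont_J_norm \<theta> u"
    and "0 \<le> cont_J_norm \<theta> u"
proof -
  note c = cont_J_components[OF u]
  have w: "locally_piecewise_continuous UNIV norm (\<lambda>t. exp (c * t))" for c :: real
    by (intro locally_piecewise_continuous_continuous continuous_intros)
  have "bdd_above {norm (improper_integral (\<lambda>t. s0 (\<phi> t) (weighted_fun0 \<theta> u t))) | \<phi>. \<phi> \<in> unit_functions}"
    unfolding weighted_fun0_def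
    by (intro A0.bdd_above_improper_integrals c(4)
        locally_piecewise_continuous_bilinear[OF bounded_bilinear_scaleR] w c(2))
  moreover have "bdd_above {norm (improper_integral (\<lambda>t. s1 (\<phi> t) (weighted_fun1 \<theta> u t))) | \<phi>. \<phi> \<in> unit_functions}"
    unfolding weighted_fun1_def
    by (intro A1.bdd_above_improper_integrals c(5)
        locally_piecewise_continuous_bilinear[OF bounded_bilinear_scaleR] w c(3))
  ultimately have bdd: "bdd_above
     ({norm (improper_integral (\<lambda>t. s0 (\<phi> t) (weighted_fun0 \<theta> u t))) | \<phi>. \<phi> \<in> unit_functions} \<union>
      {norm (improper_integral (\<lambda>t. s1 (\<phi> t) (weighted_fun1 \<theta> u t))) | \<phi>. \<phi> \<in> unit_functions})"
    by simp
  show le: "norm (improper_integral (\<lambda>t. s0 (\<phi> t) (weighted_fun0 \<theta> u t))) \<le> cont_J_norm \<theta> u"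
    unfolding cont_J_norm_def by (rule cSup_upper[OF _ bdd]) (use \<phi> in blast)
  show "norm (improper_integral (\<lambda>t. s1 (\<phi> t) (weighted_fun1 \<theta> u t))) \<le> cont_J_norm \<theta> u"
    unfolding cont_J_norm_def by (rule cSup_upper[OF _ bdd]) (use \<phi> in blast)
  show "0 \<le> cont_J_norm \<theta> u" using le norm_ge_zero order_trans by blast
qed

lemma cont_J_norm_le:
  assumes "\<And>\<phi>. \<phi> \<in> unit_functions \<Longrightarrow> norm (improper_integral (\<lambda>t. s0 (\<phi> t) (weighted_fun0 \<theta> u t))) \<le> B"
    and "\<And>\<phi>. \<phi> \<in> unit_functions \<Longrightarrow> norm (improper_integral (\<lambda>t. s1 (\<phi> t) (weighted_fun1 \<theta> u t))) \<le> B"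
  shows "cont_J_norm \<theta> u \<le> B"
proof -
  \<comment> \<open>The zero multiplier shows that the supremum runs over a nonempty set.\<close>
  have "(\<lambda>_. 0 :: 'f) \<in> unit_functions"
    by (auto simp: unit_functions_def intro: locally_piecewise_continuous_const)
  then show ?thesis
    unfolding cont_J_norm_def by (intro cSup_least) (use assms in blast)+
qed

lemma disc_J_norm_bound:
  assumes x: "x \<in> disc_J \<theta> r" and r: "r > 0" and \<theta>: "0 < \<theta>" "\<theta> < 1" and l: "l \<in> unit_sequences"
  shows "norm (bilateral_sum (\<lambda>n. s0 (l n) (weighted_seq0 \<theta> r x n))) \<le> disc_J_norm \<theta> r x"
    and "norm (bilateral_sum (\<lambda>n. s1 (l n) (weighted_seq1 \<theta> r x n))) \<le> disc_J_norm \<theta> r x"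
    and "0 \<le> disc_J_norm \<theta> r x"
proof -
  have "bdd_above {norm (bilateral_sum (\<lambda>n. s0 (l n) (weighted_seq0 \<theta> r x n))) | l. l \<in> unit_sequences}"
    using x \<theta> unfolding weighted_seq0_def disc_J_def
    by (intro A0.bdd_above_bilateral_sums[OF r]) auto
  moreover have "bdd_above {norm (bilateral_sum (\<lambda>n. s1 (l n) (weighted_seq1 \<theta> r x n))) | l. l \<in> unit_sequences}"
    using x \<theta> unfolding weighted_seq1_def disc_J_def
    by (intro A1.bdd_above_bilateral_sums[OF r]) auto
  ultimately have bdd: "bdd_above
     ({norm (bilateral_sum (\<lambda>n. s0 (l n) (weighted_seq0 \<theta> r x n))) | l. l \<in> unit_sequences} \<union>
      {norm (bilateral_sum (\<lambda>n. s1 (l n) (weighted_seq1 \<theta> r x n))) | l. l \<in> unit_sequences})"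
    by simp
  show le: "norm (bilateral_sum (\<lambda>n. s0 (l n) (weighted_seq0 \<theta> r x n))) \<le> disc_J_norm \<theta> r x"
    unfolding disc_J_norm_def by (rule cSup_upper[OF _ bdd]) (use l in blast)
  show "norm (bilateral_sum (\<lambda>n. s1 (l n) (weighted_seq1 \<theta> r x n))) \<le> disc_J_norm \<theta> r x"
    unfolding disc_J_norm_def by (rule cSup_upper[OF _ bdd]) (use l in blast)
  show "0 \<le> disc_J_norm \<theta> r x" using le norm_ge_zero order_trans by blast
qed

lemma disc_J_norm_le:
  assumes "\<And>l. l \<in> unit_sequences \<Longrightarrow> norm (bilateral_sum (\<lambda>n. s0 (l n) (weighted_seq0 \<theta> r x n))) \<le> B"
    and "\<And>l. l \<in> unit_sequences \<Longrightarrow> norm (bilateral_sum (\<lambda>n. s1 (l n) (weighted_seq1 \<theta> r x n))) \<le> B"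
  shows "disc_J_norm \<theta> r x \<le> B"
proof -
  have "(\<lambda>_. 0 :: 'f) \<in> unit_sequences" by (simp add: unit_sequences_def)
  then show ?thesis
    unfolding disc_J_norm_def by (intro cSup_least) (use assms in blast)+
qed

section \<open>Transfer of representations and comparison of the interpolation norms\<close>

lemma discretize_representation:
  assumes u: "u \<in> cont_representations \<theta> a" and r: "r > 0" and \<theta>: "0 < \<theta>" "\<theta> < 1"
  shows "\<exists>x\<in>disc_representations \<theta> r a. disc_J_norm \<theta> r x \<le> exp r * cont_J_norm \<theta> u"
proof
  have uJ: "u \<in> cont_J \<theta>" using u by (simp add: cont_representations_def)
  note c = cont_J_components[OF uJ]
  define y0 where "y0 n = integral {node r n..node r (n + 1)} (\<lambda>t. inv i0 (u t))" for n
  define y1 where "y1 n = integral {node r n..node r (n + 1)} (\<lambda>t. inv i1 (u t))" for n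
  \<comment> \<open>Defined by the integral in \<open>A\<^sub>0\<close>; agreement with the integral
    in \<open>A\<^sub>1\<close> is what places x(n) in the intersection.\<close>
  define x where "x n = i0 (y0 n)" for n
  have x1: "x n = i1 (y1 n)" for n
    unfolding x_def y0_def y1_def
    by (intro integral_embeddings_eq locally_piecewise_continuous_integrable c)
      (simp add: inter_space_embed[OF c(1)])
  have inv0: "inv i0 (x n) = y0 n" and inv1: "inv i1 (x n) = y1 n" for n
    by (simp add: x_def) (simp add: x1)
  have \<theta>': "\<bar>0 - \<theta>\<bar> \<le> 1" "\<bar>1 - \<theta>\<bar> \<le> 1" using \<theta> by auto
  note d0 = A0.discretize[OF c(2) r \<theta>'(1) c(4), folded y0_def]
  note d1 = A1.discretize[OF c(3) r \<theta>'(2) c(5), folded y1_def]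
  have xJ: "x \<in> disc_J \<theta> r"
  proof -
    have "x n \<in> inter_space" for n
      unfolding inter_space_def using x_def x1 by (metis IntI rangeI)
    moreover have "weighted_seq0 \<theta> r x = (\<lambda>n. exp ((0 - \<theta>) * r * of_int n) *\<^sub>R y0 n)"
      "weighted_seq1 \<theta> r x = (\<lambda>n. exp ((1 - \<theta>) * r * of_int n) *\<^sub>R y1 n)"
      unfolding weighted_seq0_def weighted_seq1_def inv0 inv1 by blast+
    ultimately show ?thesis using d0(1) d1(1) by (simp add: disc_J_def)
  qed
  have "(\<Sum>n = - int N..int N. x n) =
      i0 (integral {- node r (int N + 1)..node r (int N + 1)} (\<lambda>t. inv i0 (u t)))" for N
    unfolding integral_nodes[OF locally_piecewise_continuous_integrable[OF c(2)] r]
    by (simp add: x_def y0_def i0.sum)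
  moreover have "((\<lambda>R. sum_norm (i0 (integral {-R..R} (\<lambda>t. inv i0 (u t))) - a)) \<longlongrightarrow> 0) at_top"
    "a \<in> sum_space"
    using u by (auto simp: cont_representations_def)
  ultimately show "x \<in> disc_representations \<theta> r a"
    using xJ filterlim_compose[OF _ filterlim_node[OF r]]
    by (auto simp: disc_representations_def)
  show "disc_J_norm \<theta> r x \<le> exp r * cont_J_norm \<theta> u"
  proof (rule disc_J_norm_le)
    fix l :: "int \<Rightarrow> 'f" assume l: "l \<in> unit_sequences"
    show "norm (bilateral_sum (\<lambda>n. s0 (l n) (weighted_seq0 \<theta> r x n))) \<le> exp r * cont_J_norm \<theta> u"
      using d0(2)[OF _ l] cont_J_norm_bound(1)[OF uJ]
      unfolding weighted_seq0_def inv0 weighted_fun0_def by fastforce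
    show "norm (bilateral_sum (\<lambda>n. s1 (l n) (weighted_seq1 \<theta> r x n))) \<le> exp r * cont_J_norm \<theta> u"
      using d1(2)[OF _ l] cont_J_norm_bound(2)[OF uJ]
      unfolding weighted_seq1_def inv1 weighted_fun1_def by fastforce
  qed
qed

text \<open>The delicate point is that the integrals of u converge to a over all radii. The pieces
  cut off at the two ends are multiples of x(-N) and x(N); neither need be small in both spaces, but
  the sum norm allows each to be measured where it is.\<close>

lemma continuize_representation:
  assumes x: "x \<in> disc_representations \<theta> r a" and r: "r > 0" and \<theta>: "0 < \<theta>" "\<theta> < 1"
  shows "\<exists>u\<in>cont_representations \<theta> a. cont_J_norm \<theta> u \<le> exp r * disc_J_norm \<theta> r x"
proof
  have xJ: "x \<in> disc_J \<theta> r" and a: "a \<in> sum_space"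
    and lim: "(\<lambda>N. sum_norm ((\<Sum>n = - int N..int N. x n) - a)) \<longlonglongrightarrow> 0"
    using x by (auto simp: disc_representations_def)
  have xI: "x n \<in> inter_space" for n using xJ by (simp add: disc_J_def)
  define z0 where "z0 n = inv i0 (x n)" for n
  define z1 where "z1 n = inv i1 (x n)" for n
  have z: "i0 (z0 n) = x n" "i1 (z1 n) = x n" for n
    by (simp_all add: z0_def z1_def inter_space_embed[OF xI])
  define u where "u t = i0 ((1 / r) *\<^sub>R z0 (cell r t))" for t
  have u1: "u t = i1 ((1 / r) *\<^sub>R z1 (cell r t))" for t
    by (simp add: u_def scaleR_embedding z)
  have inv0: "inv i0 (u t) = (1 / r) *\<^sub>R z0 (cell r t)" and inv1: "inv i1 (u t) = (1 / r) *\<^sub>R z1 (cell r t)" for t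
    by (simp add: u_def) (simp add: u1)
  have \<theta>': "\<bar>0 - \<theta>\<bar> \<le> 1" "\<bar>1 - \<theta>\<bar> \<le> 1" using \<theta> by auto
  have uc: "unconditionally_convergent s0 (\<lambda>n. exp ((0 - \<theta>) * r * of_int n) *\<^sub>R z0 n)"
    "unconditionally_convergent s1 (\<lambda>n. exp ((1 - \<theta>) * r * of_int n) *\<^sub>R z1 n)"
    using xJ unfolding disc_J_def weighted_seq0_def weighted_seq1_def z0_def z1_def by blast+
  note c0 = A0.continuize[OF r \<theta>'(1) _ uc(1), folded inv0]
  note c1 = A1.continuize[OF r \<theta>'(2) _ uc(2), folded inv1]
  have "i0 ((1 / r) *\<^sub>R z0 n) \<in> inter_space" for n
  proof -
    have "i0 ((1 / r) *\<^sub>R z0 n) = i1 ((1 / r) *\<^sub>R z1 n)" by (simp add: scaleR_embedding z)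
    then show ?thesis unfolding inter_space_def by (metis IntI rangeI)
  qed
  then have "locally_piecewise_continuous inter_space inter_norm u"
    unfolding u_def
    by (rule locally_piecewise_continuous_cell[where v = "\<lambda>n. i0 ((1 / r) *\<^sub>R z0 n)" and
          N = inter_norm and C = inter_space, OF r inter_norm_0])
  then have uJ: "u \<in> cont_J \<theta>"
    using c0(1) c1(1) by (auto simp: cont_J_def weighted_fun0_def weighted_fun1_def)
  define G where "G R = integral {-R..R} (\<lambda>t. inv i0 (u t))" for R
  have int: "(\<lambda>t. inv i0 (u t)) integrable_on {s..t}" for s t
    by (rule locally_piecewise_continuous_integrable[OF cont_J_components(2)[OF uJ]])
  have part: "integral {s..t} (\<lambda>t. inv i0 (u t)) = ((t - s) / r) *\<^sub>R z0 n"
    if "node r n \<le> s" "s \<le> t" "t \<le> node r (n + 1)" for s t n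
    unfolding inv0 using integral_cell[OF r that, of "\<lambda>n. (1 / r) *\<^sub>R z0 n"] by simp
  have G_node: "i0 (G (node r (int N + 1))) = (\<Sum>n = - int N..int N. x n)" for N
  proof -
    have "integral {node r n..node r (n + 1)} (\<lambda>t. inv i0 (u t)) = z0 n" for n
      using part[of n "node r n" "node r (n + 1)"] r by (simp add: node_Suc)
    then show ?thesis unfolding G_def integral_nodes[OF int r] by (simp add: i0.sum z)
  qed
  have G_sum_space: "i0 (G R) - a \<in> sum_space" for R
  proof -
    obtain p q where "a = i0 p + i1 q" using a by (auto simp: sum_space_def)
    then have "i0 (G R) - a = i0 (G R - p) + i1 (- q)" by (simp add: i0.diff i1.neg)
    then show ?thesis by (auto simp: sum_space_def)
  qed
  have "((\<lambda>R. sum_norm (i0 (G R) - a)) \<longlongrightarrow> 0) at_top"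
  proof (rule tendsto_at_top_from_nodes[OF r])
    show "(\<lambda>N. sum_norm (i0 (G (node r (int N + 1))) - a)) \<longlonglongrightarrow> 0"
      using lim by (simp add: G_node)
    \<comment> \<open>For negative indices the weight with exponent -\<theta> is at least 1, so
      weighted convergence in \<open>A\<^sub>0\<close> gives unweighted convergence; for positive
      indices the weight with exponent 1 - \<theta> does the same in
      \<open>A\<^sub>1\<close>.\<close>
    have "(\<lambda>N. z0 (- int N)) \<longlonglongrightarrow> 0"
    proof (rule Lim_null_comparison[OF _ tendsto_norm_zero[OF A0.unconditionally_convergent_tendsto_0(2)[OF uc(1)]]])
      have "1 * norm (z0 (- int N)) \<le> exp (\<theta> * r * N) * norm (z0 (- int N))" for N
        using r \<theta> by (intro mult_right_mono) auto
      then show "\<forall>\<^sub>F N in sequentially. norm (z0 (- int N)) \<le>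
          norm (exp ((0 - \<theta>) * r * of_int (- int N)) *\<^sub>R z0 (- int N))" by simp
    qed
    moreover have "(\<lambda>N. z1 (int N)) \<longlonglongrightarrow> 0"
    proof (rule Lim_null_comparison[OF _ tendsto_norm_zero[OF A1.unconditionally_convergent_tendsto_0(1)[OF uc(2)]]])
      have "1 * norm (z1 (int N)) \<le> exp ((1 - \<theta>) * r * N) * norm (z1 (int N))" for N
        using r \<theta> by (intro mult_right_mono) auto
      then show "\<forall>\<^sub>F N in sequentially. norm (z1 (int N)) \<le>
          norm (exp ((1 - \<theta>) * r * of_int (int N)) *\<^sub>R z1 (int N))" by simp
    qed
    ultimately show "(\<lambda>N. norm (z0 (- int N)) + norm (z1 (int N))) \<longlonglongrightarrow> 0"
      by (auto intro!: tendsto_eq_intros)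
    fix N R
    assume R: "0 \<le> R" "node r (int N) \<le> R" "R \<le> node r (int N + 1)"
    \<comment> \<open>The share of a cell that the radius R cuts off at each end.\<close>
    define \<rho> where "\<rho> = (node r (int N + 1) - R) / r"
    have "node r (int N + 1) - R \<le> r" using R node_Suc[of r "int N"] by linarith
    then have \<rho>: "0 \<le> \<rho>" "\<rho> \<le> 1" using R r by (simp_all add: \<rho>_def)
    have "G (node r (int N + 1)) - G R = \<rho> *\<^sub>R z0 (- int N) + \<rho> *\<^sub>R z0 (int N)"
      unfolding G_def integral_symmetric_diff[OF int R(1,3)]
      using R node_uminus[of r "int N"] node_uminus[of r "int N - 1"]
      by (subst (1 2) part[of "- int N"] part[of "int N"]) (auto simp: \<rho>_def)
    then have "G (node r (int N + 1)) = G R + \<rho> *\<^sub>R z0 (- int N) + \<rho> *\<^sub>R z0 (int N)"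
      by (simp add: algebra_simps)
    \<comment> \<open>The right-hand piece, computed in \<open>A\<^sub>0\<close>, is rewritten as an
      element of \<open>A\<^sub>1\<close>, where it is small.\<close>
    then have eq: "i0 (G (node r (int N + 1))) - a =
        (i0 (G R) - a) + (i0 (\<rho> *\<^sub>R z0 (- int N)) + i1 (\<rho> *\<^sub>R z1 (int N)))"
      by (simp add: i0.add scaleR_embedding z)
    then have eq': "i0 (G R) - a = (i0 (G (node r (int N + 1))) - a) +
        (i0 (- (\<rho> *\<^sub>R z0 (- int N))) + i1 (- (\<rho> *\<^sub>R z1 (int N))))"
      by (simp add: i0.neg i1.neg)
    have small: "norm (\<rho> *\<^sub>R z0 (- int N)) + norm (\<rho> *\<^sub>R z1 (int N)) \<le> norm (z0 (- int N)) + norm (z1 (int N))"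
      using \<rho> by (intro add_mono) (simp_all add: mult_left_le_one_le)
    have "sum_norm (i0 (G (node r (int N + 1))) - a) \<le> sum_norm (i0 (G R) - a) +
        (norm (\<rho> *\<^sub>R z0 (- int N)) + norm (\<rho> *\<^sub>R z1 (int N)))"
      unfolding eq by (rule sum_norm_add_le[OF G_sum_space])
    moreover have "sum_norm (i0 (G R) - a) \<le> sum_norm (i0 (G (node r (int N + 1))) - a) +
        (norm (- (\<rho> *\<^sub>R z0 (- int N))) + norm (- (\<rho> *\<^sub>R z1 (int N))))"
      by (subst eq', rule sum_norm_add_le[OF G_sum_space])
    ultimately show "norm (sum_norm (i0 (G R) - a) - sum_norm (i0 (G (node r (int N + 1))) - a))
        \<le> norm (z0 (- int N)) + norm (z1 (int N))"
      using small by simp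
  qed
  then show "u \<in> cont_representations \<theta> a"
    using uJ a by (simp add: cont_representations_def G_def)
  show "cont_J_norm \<theta> u \<le> exp r * disc_J_norm \<theta> r x"
  proof (rule cont_J_norm_le)
    fix \<phi> :: "real \<Rightarrow> 'f" assume \<phi>: "\<phi> \<in> unit_functions"
    show "norm (improper_integral (\<lambda>t. s0 (\<phi> t) (weighted_fun0 \<theta> u t))) \<le> exp r * disc_J_norm \<theta> r x"
      using c0(2)[OF \<phi>] disc_J_norm_bound(1)[OF xJ r \<theta>]
      unfolding weighted_seq0_def z0_def weighted_fun0_def by fastforce
    show "norm (improper_integral (\<lambda>t. s1 (\<phi> t) (weighted_fun1 \<theta> u t))) \<le> exp r * disc_J_norm \<theta> r x"
      using c1(2)[OF \<phi>] disc_J_norm_bound(2)[OF xJ r \<theta>]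
      unfolding weighted_seq1_def z1_def weighted_fun1_def by fastforce
  qed
qed

lemma disc_norm_tendsto_cont_norm:
  assumes \<theta>: "0 < \<theta>" "\<theta> < 1" and a: "a \<in> cont_space \<theta>"
  shows "((\<lambda>r. disc_norm \<theta> r a) \<longlongrightarrow> cont_norm \<theta> a) (at_right 0)"
proof (rule tendsto_sandwich)
  have zero: "(\<lambda>_. 0 :: 'f) \<in> unit_functions" "(\<lambda>_. 0 :: 'f) \<in> unit_sequences"
    by (auto simp: unit_functions_def unit_sequences_def intro: locally_piecewise_continuous_const)
  have cont: "cont_representations \<theta> a \<noteq> {}" using a by (simp add: cont_space_def)
  have upper: "disc_norm \<theta> r a \<le> exp r * cont_norm \<theta> a" if "r > 0" for r
    unfolding disc_norm_def cont_norm_def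
    using disc_J_norm_bound(3)[OF _ that \<theta> zero(2)] discretize_representation[OF _ that \<theta>]
    by (intro Inf_le_scaled_Inf cont) (auto simp: disc_representations_def)
  have lower: "cont_norm \<theta> a \<le> exp r * disc_norm \<theta> r a" if "r > 0" for r
    unfolding disc_norm_def cont_norm_def
  proof (rule Inf_le_scaled_Inf)
    \<comment> \<open>A continuous representation exists by hypothesis, and discretizing it shows
      that the discrete infimum is over a nonempty set.\<close>
    show "disc_representations \<theta> r a \<noteq> {}"
      using cont discretize_representation[OF _ that \<theta>] by blast
  qed (use cont_J_norm_bound(3)[OF _ zero(1)] continuize_representation[OF _ that \<theta>] in
      \<open>auto simp: cont_representations_def\<close>)
  show "eventually (\<lambda>r. disc_norm \<theta> r a \<le> exp r * cont_norm \<theta> a) (at_right 0)"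
    using eventually_at_right_less[of 0] by eventually_elim (rule upper)
  show "eventually (\<lambda>r. exp (- r) * cont_norm \<theta> a \<le> disc_norm \<theta> r a) (at_right 0)"
    using eventually_at_right_less[of 0]
    by eventually_elim (use lower in \<open>simp add: exp_minus field_simps\<close>)
  show "((\<lambda>r. exp r * cont_norm \<theta> a) \<longlongrightarrow> cont_norm \<theta> a) (at_right 0)"
    "((\<lambda>r. exp (- r) * cont_norm \<theta> a) \<longlongrightarrow> cont_norm \<theta> a) (at_right 0)"
    by (auto intro!: tendsto_eq_intros)
qed

end

theorem mainTheorem2:
  fixes s0 :: "'f :: {real_normed_field, banach} \<Rightarrow> 'a :: banach \<Rightarrow> 'a"
    and s1 :: "'f \<Rightarrow> 'b :: banach \<Rightarrow> 'b"
    and sV :: "'f \<Rightarrow> 'v :: {topological_ab_group_add, t2_space} \<Rightarrow> 'v"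
    and i0 :: "'a \<Rightarrow> 'v" and i1 :: "'b \<Rightarrow> 'v"
    and \<theta> :: real and a :: 'v
  assumes "banach_couple s0 s1 sV i0 i1"
    and "0 < \<theta>" and "\<theta> < 1"
    and "a \<in> banach_couple.cont_space s0 s1 i0 i1 \<theta>"
  shows "((\<lambda>r. banach_couple.disc_norm s0 s1 i0 i1 \<theta> r a) \<longlongrightarrow>
           banach_couple.cont_norm s0 s1 i0 i1 \<theta> a) (at_right 0)"
  using assms by (intro banach_couple.disc_norm_tendsto_cont_norm)

end
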